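(* Let $x:M^2\to\mathbb{C}^2$ be a compact orientable Lagrangian self-shrinker. If the squared norm of the second fundamental form satisfies $|A|^2\le 2$ everywhere on $M^2$, then $|A|^2\equiv 2$ and $x(M^2)$ is, up to an isometry of $\mathbb{C}^2$, the Clifford torus $\mathbb{S}^1(1)\times\mathbb{S}^1(1)=\{(z_1,z_2)\in\mathbb{C}^2: |z_1|=|z_2|=1\}$ (i.e. $x$ is congruent to $(s,t)\mapsto(e^{is},e^{it})$).
   Context: All manifolds are connected and without boundary; "compact" means closed. An immersion $x:M^n\to\mathbb{R}^{n+p}$ is a self-shrinker if $\mathbf{H}=-x^{\perp}$, where $\mathbf{H}$ is the mean curvature vector (the trace of the second fundamental form $h$, not normalized by $1/n$) and $x^\perp$ is the projection of the position vector onto the normal bundle. An immersion $x:M^2\to\mathbb{C}^2\cong\mathbb{R}^4$ is Lagrangian if the standard complex structure $J$ maps each tangent space $T_pM$ onto the normal space at $p$. A Lagrangian self-shrinker is a Lagrangian immersion satisfying the self-shrinker equation. $|A|^2=\sum_{i,j}|h(e_i,e_j)|^2$ for an orthonormal tangent frame $e_1,e_2$. *)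

theory Defs
  imports "HOL-Analysis.Analysis"
begin

fun Ck :: "nat \<Rightarrow> 'a::real_normed_vector set \<Rightarrow> ('a \<Rightarrow> 'b::real_normed_vector) \<Rightarrow> bool" where
  "Ck 0 U f = continuous_on U f"
| "Ck (Suc k) U f = ((\<forall>p\<in>U. f differentiable (at p)) \<and>
                     (\<forall>v. Ck k U (\<lambda>p. frechet_derivative f (at p) v)))"

definition smooth_on :: "'a::real_normed_vector set \<Rightarrow> ('a \<Rightarrow> 'b::real_normed_vector) \<Rightarrow> bool" where
  "smooth_on U f \<longleftrightarrow> (\<forall>k. Ck k U f)"

definition pd :: "nat \<Rightarrow> (real \<times> real \<Rightarrow> 'b::real_normed_vector) \<Rightarrow> real \<times> real \<Rightarrow> 'b" where
  "pd i f p = frechet_derivative f (at p) (if i = 0 then (1,0) else (0,1))"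

definition jac :: "(real \<times> real \<Rightarrow> real \<times> real) \<Rightarrow> real \<times> real \<Rightarrow> real" where
  "jac \<tau> p = fst (pd 0 \<tau> p) * snd (pd 1 \<tau> p) - snd (pd 0 \<tau> p) * fst (pd 1 \<tau> p)"

definition oriented_surface_atlas ::
  "((real \<times> real) set \<times> (real \<times> real \<Rightarrow> 'm::topological_space)) set \<Rightarrow> bool" where
  "oriented_surface_atlas A \<longleftrightarrow>
     (\<forall>(U,\<phi>)\<in>A. open U \<and> open (\<phi> ` U) \<and> (\<exists>\<psi>. homeomorphism U (\<phi> ` U) \<phi> \<psi>)) \<and>
     (\<Union>(U,\<phi>)\<in>A. \<phi> ` U) = UNIV \<and>
     (\<forall>(U,\<phi>)\<in>A. \<forall>(V,\<psi>)\<in>A.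
        smooth_on {p\<in>U. \<phi> p \<in> \<psi> ` V} (\<lambda>p. inv_into V \<psi> (\<phi> p)) \<and>
        (\<forall>p\<in>{p\<in>U. \<phi> p \<in> \<psi> ` V}. jac (\<lambda>p. inv_into V \<psi> (\<phi> p)) p > 0))"

type_synonym param = "real \<times> real \<Rightarrow> complex \<times> complex"

definition tang :: "param \<Rightarrow> nat \<Rightarrow> real \<times> real \<Rightarrow> complex \<times> complex" where
  "tang f i p = pd i f p"

definition sec :: "param \<Rightarrow> nat \<Rightarrow> nat \<Rightarrow> real \<times> real \<Rightarrow> complex \<times> complex" where
  "sec f i j p = pd j (tang f i) p"

definition gm :: "param \<Rightarrow> nat \<Rightarrow> nat \<Rightarrow> real \<times> real \<Rightarrow> real" where
  "gm f i j p = tang f i p \<bullet> tang f j p"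

definition detg :: "param \<Rightarrow> real \<times> real \<Rightarrow> real" where
  "detg f p = gm f 0 0 p * gm f 1 1 p - gm f 0 1 p * gm f 1 0 p"

definition ginv :: "param \<Rightarrow> nat \<Rightarrow> nat \<Rightarrow> real \<times> real \<Rightarrow> real" where
  "ginv f i j p = (if i = j then gm f (1 - i) (1 - j) p else - gm f i j p) / detg f p"

text \<open>Immersion: the two partial derivatives are linearly independent.\<close>
definition immersion_at :: "param \<Rightarrow> real \<times> real \<Rightarrow> bool" where
  "immersion_at f p \<longleftrightarrow> detg f p > 0"

definition tproj :: "param \<Rightarrow> real \<times> real \<Rightarrow> complex \<times> complex \<Rightarrow> complex \<times> complex" where
  "tproj f p v = (\<Sum>i\<in>{0,1}. \<Sum>j\<in>{0,1}. (ginv f i j p * (v \<bullet> tang f i p)) *\<^sub>R tang f j p)"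

definition nproj :: "param \<Rightarrow> real \<times> real \<Rightarrow> complex \<times> complex \<Rightarrow> complex \<times> complex" where
  "nproj f p v = v - tproj f p v"

definition sff :: "param \<Rightarrow> nat \<Rightarrow> nat \<Rightarrow> real \<times> real \<Rightarrow> complex \<times> complex" where
  "sff f i j p = nproj f p (sec f i j p)"

definition meancurv :: "param \<Rightarrow> real \<times> real \<Rightarrow> complex \<times> complex" where
  "meancurv f p = (\<Sum>i\<in>{0,1}. \<Sum>j\<in>{0,1}. ginv f i j p *\<^sub>R sff f i j p)"

definition sqA :: "param \<Rightarrow> real \<times> real \<Rightarrow> real" where
  "sqA f p = (\<Sum>i\<in>{0,1}. \<Sum>j\<in>{0,1}. \<Sum>k\<in>{0,1}. \<Sum>l\<in>{0,1}.
                ginv f i k p * ginv f j l p * (sff f i j p \<bullet> sff f k l p))"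

definition cJ :: "complex \<times> complex \<Rightarrow> complex \<times> complex" where
  "cJ z = (\<i> * fst z, \<i> * snd z)"

definition lagrangian_at :: "param \<Rightarrow> real \<times> real \<Rightarrow> bool" where
  "lagrangian_at f p \<longleftrightarrow>
     cJ ` span {tang f 0 p, tang f 1 p} = {v. v \<bullet> tang f 0 p = 0 \<and> v \<bullet> tang f 1 p = 0}"

definition self_shrinker_at :: "param \<Rightarrow> real \<times> real \<Rightarrow> bool" where
  "self_shrinker_at f p \<longleftrightarrow> meancurv f p = - nproj f p (f p)"

definition clifford_torus :: "(complex \<times> complex) set" where
  "clifford_torus = {(z1, z2). cmod z1 = 1 \<and> cmod z2 = 1}"

end

theory Submission
  imports Defs
begin

text \<open>No topology of the surface enters the proof. At a maximum of \<open>|x|^2\<close> the position vector is normal,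
  so \<open>x = - H\<close>; let \<open>e1 = J x / |x|\<close> and let \<open>e2\<close> be the unit tangent orthogonal to it. The Hessian of
  \<open>|x|^2\<close> in the direction \<open>e2\<close>, the bound \<open>|A|^2 \<le> 2\<close> and the total symmetry of the cubic form
  \<open>\<langle>h(u,v), J w\<rangle>\<close> together force \<open>|x|^2 = 2\<close> there. Hence \<open>|x|^2 \<le> 2\<close> everywhere, so
  \<open>\<Delta> |x|^2 = 2 (2 - |H|^2) \<ge> 0\<close>, and the strong maximum principle gives \<open>|x|^2 = 2\<close> identically.
  The second fundamental form is then that of the Clifford torus, and
  \<open>x = P + Q\<close> with \<open>P = (x - \<surd>2 J e2) / 2\<close>, \<open>Q = (x + \<surd>2 J e2) / 2\<close>. These are Hermitian orthogonal
  unit vectors whose derivatives are real multiples of \<open>J P\<close> and \<open>J Q\<close>, so each stays on a fixed unit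
  circle in a fixed complex line. The image is therefore contained in a congruent copy of the Clifford
  torus, in which it is open and closed.\<close>

section \<open>Second derivatives in the plane\<close>

text \<open>At a maximum of \<open>|x|^2\<close> write \<open>a = <h(e1,e1), J e1>\<close>,
  \<open>k = <h(e2,e2), J e1>\<close>, \<open>b = <h(e1,e1), J e2>\<close>. Testing the direction
  \<open>e2\<close> matters: its Hessian inequality \<open>1 <= |x| k\<close> bounds from below the
  component that total symmetry counts three times in \<open>|A|^2\<close>. The direction
  \<open>e1\<close> would give only \<open>1 <= |x| a\<close>, which \<open>a = 1\<close>,
  \<open>k = b = 0\<close> satisfies with \<open>|x| = 1\<close>.

  Once \<open>|x|^2 = 2\<close>, the cubic form has \<open>a = k = 1 / sqrt 2\<close> and its other
  components vanish. On \<open>u1 e1 + u2 e2\<close> it equals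
  \<open>(u1^3 + 3 u1 u2^2) / sqrt 2\<close>, that is,
  \<open>((u1 + u2)^3 + (u1 - u2)^3) / (2 sqrt 2)\<close>. It splits into two cubes along the
  diagonals of the frame, and \<open>P\<close>, \<open>Q\<close> are \<open>-J\<close> applied to
  the unit vectors along \<open>e1 + e2\<close> and \<open>e1 - e2\<close>.

  The position determines \<open>e1\<close>, but the tangent plane determines \<open>e2\<close> only
  up to sign, and reversing that sign exchanges \<open>P\<close> and \<open>Q\<close>. Comparison
  between charts therefore uses the unordered pair of complex lines.\<close>

lemma has_derivative_pd:
  assumes "f differentiable (at p)"
  shows "(f has_derivative (\<lambda>h. fst h *\<^sub>R pd 0 f p + snd h *\<^sub>R pd 1 f p)) (at p)"
proof -
  let ?D = "frechet_derivative f (at p)"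
  have D: "(f has_derivative ?D) (at p)"
    using assms frechet_derivative_works by blast
  then interpret bounded_linear ?D by (rule has_derivative_bounded_linear)
  have "?D h = fst h *\<^sub>R pd 0 f p + snd h *\<^sub>R pd 1 f p" for h
  proof -
    have "h = fst h *\<^sub>R (1,0) + snd h *\<^sub>R (0,1)" by (simp add: prod_eq_iff)
    then have "?D h = ?D (fst h *\<^sub>R (1,0) + snd h *\<^sub>R (0,1))" by simp
    also have "\<dots> = fst h *\<^sub>R pd 0 f p + snd h *\<^sub>R pd 1 f p"
      by (simp add: add scale pd_def del: scaleR_Pair)
    finally show ?thesis .
  qed
  then have "?D = (\<lambda>h. fst h *\<^sub>R pd 0 f p + snd h *\<^sub>R pd 1 f p)" by blast
  with D show ?thesis by simp
qed

lemma differentiable_along_line: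
  fixes g :: "real \<times> real \<Rightarrow> real"
  assumes "(g has_derivative (\<lambda>h. fst h *\<^sub>R a + snd h *\<^sub>R b)) (at (p + t *\<^sub>R v))"
  shows "((\<lambda>t. g (p + t *\<^sub>R v)) has_real_derivative (fst v * a + snd v * b)) (at t)"
proof -
  have "((\<lambda>t. p + t *\<^sub>R v) has_derivative (\<lambda>t. t *\<^sub>R v)) (at t)"
    by (auto intro!: derivative_eq_intros)
  from has_derivative_compose [OF this assms]
  have "((\<lambda>t. g (p + t *\<^sub>R v)) has_derivative (\<lambda>x. x * (fst v * a + snd v * b))) (at t)"
    by (simp add: algebra_simps)
  then show ?thesis
    by (simp add: has_field_derivative_def mult_commute_abs)
qed

text \<open>Both mixed second partials are limits of the same second difference quotient.\<close>

lemma mixed_difference_mvt: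
  fixes g :: "real \<times> real \<Rightarrow> real"
  assumes h: "0 < h"
    and sub: "\<And>s t. a \<le> s \<Longrightarrow> s \<le> a + h \<Longrightarrow> b \<le> t \<Longrightarrow> t \<le> b + h \<Longrightarrow> (s, t) \<in> U"
    and g: "\<And>q. q \<in> U \<Longrightarrow> (g has_derivative (\<lambda>h. fst h *\<^sub>R g0 q + snd h *\<^sub>R g1 q)) (at q)"
    and g0: "\<And>q. q \<in> U \<Longrightarrow> (g0 has_derivative (\<lambda>h. fst h *\<^sub>R g00 q + snd h *\<^sub>R g01 q)) (at q)"
  shows "\<exists>s t. a \<le> s \<and> s \<le> a + h \<and> b \<le> t \<and> t \<le> b + h \<and>
           g (a + h, b + h) - g (a + h, b) - g (a, b + h) + g (a, b) = h * h * g01 (s, t)"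
proof -
  have ds: "((\<lambda>s. g (s, t)) has_real_derivative g0 (s, t)) (at s)" if "(s, t) \<in> U" for s t
    using differentiable_along_line[of g "g0 (s,t)" "g1 (s,t)" "(0, t)" s "(1, 0)"] g[OF that] by simp
  have dt: "((\<lambda>t. g0 (s, t)) has_real_derivative g01 (s, t)) (at t)" if "(s, t) \<in> U" for s t
    using differentiable_along_line[of g0 "g00 (s,t)" "g01 (s,t)" "(s, 0)" t "(0, 1)"] g0[OF that] by simp
  have "\<exists>z. a < z \<and> z < a + h \<and> (g (a + h, b + h) - g (a + h, b)) - (g (a, b + h) - g (a, b))
      = (a + h - a) * (g0 (z, b + h) - g0 (z, b))"
    using h by (intro MVT2 DERIV_diff ds sub) auto
  then obtain z where z: "a < z" "z < a + h"
    and ez: "(g (a + h, b + h) - g (a + h, b)) - (g (a, b + h) - g (a, b)) = h * (g0 (z, b + h) - g0 (z, b))"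
    by auto
  have "\<exists>y. b < y \<and> y < b + h \<and> g0 (z, b + h) - g0 (z, b) = (b + h - b) * g01 (z, y)"
    using h z by (intro MVT2 dt sub) auto
  then obtain y where "b < y" "y < b + h" "g0 (z, b + h) - g0 (z, b) = h * g01 (z, y)"
    by auto
  with z ez show ?thesis
    by (intro exI[of _ z] exI[of _ y]) (simp add: algebra_simps)
qed

lemma mixed_partials_eq_real:
  fixes g :: "real \<times> real \<Rightarrow> real"
  assumes "open U" "p \<in> U"
    and g: "\<And>q. q \<in> U \<Longrightarrow> (g has_derivative (\<lambda>h. fst h *\<^sub>R g0 q + snd h *\<^sub>R g1 q)) (at q)"
    and g0: "\<And>q. q \<in> U \<Longrightarrow> (g0 has_derivative (\<lambda>h. fst h *\<^sub>R g00 q + snd h *\<^sub>R g01 q)) (at q)"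
    and g1: "\<And>q. q \<in> U \<Longrightarrow> (g1 has_derivative (\<lambda>h. fst h *\<^sub>R g10 q + snd h *\<^sub>R g11 q)) (at q)"
    and c01: "continuous_on U g01" and c10: "continuous_on U g10"
  shows "g01 p = g10 p"
proof (rule ccontr)
  assume ne: "g01 p \<noteq> g10 p"
  define e where "e = \<bar>g01 p - g10 p\<bar> / 2"
  have e: "e > 0" using ne by (simp add: e_def)
  have "isCont g01 p" "isCont g10 p"
    using c01 c10 assms(1,2) continuous_on_eq_continuous_at by blast+
  then obtain d1 d2 where d: "d1 > 0" "\<And>q. dist q p < d1 \<Longrightarrow> dist (g01 q) (g01 p) < e"
      "d2 > 0" "\<And>q. dist q p < d2 \<Longrightarrow> dist (g10 q) (g10 p) < e"
    using e unfolding continuous_at_eps_delta by metis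
  obtain r where r: "r > 0" "ball p r \<subseteq> U"
    using assms(1,2) openE by blast
  obtain a b where p: "p = (a, b)" by force
  \<comment> \<open>The point \<open>p\<close> is a corner of the square of side \<open>h\<close>,
    so every point of the square lies within \<open>2 * h\<close> of it.\<close>
  define h where "h = min r (min d1 d2) / 4"
  have h: "h > 0" using r d by (simp add: h_def)
  have near: "dist (s, t) p < min r (min d1 d2)" if "a \<le> s" "s \<le> a + h" "b \<le> t" "t \<le> b + h" for s t
  proof -
    have "dist (s, t) p = norm (s - a, t - b)" by (simp add: p dist_norm)
    also have "\<dots> \<le> norm (s - a) + norm (t - b)" by (rule norm_Pair_le)
    also have "\<dots> \<le> h + h" using that by (intro add_mono) auto
    also have "\<dots> < min r (min d1 d2)" using r d h unfolding h_def by linarith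
    finally show ?thesis .
  qed
  have sub: "(s, t) \<in> U" if "a \<le> s" "s \<le> a + h" "b \<le> t" "t \<le> b + h" for s t
    using near[OF that] r by (auto simp: dist_commute)
  obtain s t where st: "a \<le> s" "s \<le> a + h" "b \<le> t" "t \<le> b + h"
    and e1: "g (a + h, b + h) - g (a + h, b) - g (a, b + h) + g (a, b) = h * h * g01 (s, t)"
    using mixed_difference_mvt[OF h sub g g0] by blast
  \<comment> \<open>Exchanging the coordinates leaves the second difference unchanged, and the mean
    value lemma then produces \<open>g10\<close> in place of \<open>g01\<close>.\<close>
  let ?k = "\<lambda>q::real\<times>real. (snd q, fst q)"
  have sw: "bounded_linear ?k"
    by (intro bounded_linear_Pair bounded_linear_fst bounded_linear_snd)
  have comp: "((\<lambda>q. f (?k q)) has_derivative (\<lambda>h. fst h *\<^sub>R fb (?k q) + snd h *\<^sub>R fa (?k q))) (at q)"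
    if "\<And>q. q \<in> U \<Longrightarrow> (f has_derivative (\<lambda>h. fst h *\<^sub>R fa q + snd h *\<^sub>R fb q)) (at q)" "?k q \<in> U"
    for f fa fb :: "real \<times> real \<Rightarrow> real" and q
    using has_derivative_compose[OF bounded_linear_imp_has_derivative[OF sw] that(1)[OF that(2)]]
    by (simp add: add.commute)
  have "\<exists>t' s'. b \<le> t' \<and> t' \<le> b + h \<and> a \<le> s' \<and> s' \<le> a + h \<and>
      g (?k (b + h, a + h)) - g (?k (b + h, a)) - g (?k (b, a + h)) + g (?k (b, a)) = h * h * g10 (?k (t', s'))"
  proof (rule mixed_difference_mvt[OF h, where U = "{q. ?k q \<in> U}" and g = "\<lambda>q. g (?k q)"
        and ?g0.0 = "\<lambda>q. g1 (?k q)" and ?g1.0 = "\<lambda>q. g0 (?k q)"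
        and ?g00.0 = "\<lambda>q. g11 (?k q)" and ?g01.0 = "\<lambda>q. g10 (?k q)"])
    show "(t, s) \<in> {q. ?k q \<in> U}" if "b \<le> t" "t \<le> b + h" "a \<le> s" "s \<le> a + h" for t s
      using sub that by simp
    show "((\<lambda>q. g (?k q)) has_derivative (\<lambda>h. fst h *\<^sub>R g1 (?k q) + snd h *\<^sub>R g0 (?k q))) (at q)"
      if "q \<in> {q. ?k q \<in> U}" for q
      using that by (intro comp[of g g0 g1, OF g]) auto
    show "((\<lambda>q. g1 (?k q)) has_derivative (\<lambda>h. fst h *\<^sub>R g11 (?k q) + snd h *\<^sub>R g10 (?k q))) (at q)"
      if "q \<in> {q. ?k q \<in> U}" for q
      using that by (intro comp[of g1 g10 g11, OF g1]) auto
  qed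
  then obtain t' s' where st': "b \<le> t'" "t' \<le> b + h" "a \<le> s'" "s' \<le> a + h"
    and e2: "g (a + h, b + h) - g (a, b + h) - g (a + h, b) + g (a, b) = h * h * g10 (s', t')"
    by auto
  have "h * h * g01 (s, t) = h * h * g10 (s', t')" using e1 e2 by linarith
  then have "g01 (s, t) = g10 (s', t')" using h by simp
  moreover have "dist (g01 (s, t)) (g01 p) < e" "dist (g10 (s', t')) (g10 p) < e"
    using near[OF st] near[OF st'(3,4,1,2)] d(2)[of "(s,t)"] d(4)[of "(s',t')"] by auto
  ultimately show False by (simp add: dist_real_def e_def abs_if split: if_splits)
qed

lemma mixed_partials_eq:
  fixes g :: "real \<times> real \<Rightarrow> 'a::real_inner"
  assumes "open U" "p \<in> U"
    and g: "\<And>q. q \<in> U \<Longrightarrow> (g has_derivative (\<lambda>h. fst h *\<^sub>R g0 q + snd h *\<^sub>R g1 q)) (at q)"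
    and g0: "\<And>q. q \<in> U \<Longrightarrow> (g0 has_derivative (\<lambda>h. fst h *\<^sub>R g00 q + snd h *\<^sub>R g01 q)) (at q)"
    and g1: "\<And>q. q \<in> U \<Longrightarrow> (g1 has_derivative (\<lambda>h. fst h *\<^sub>R g10 q + snd h *\<^sub>R g11 q)) (at q)"
    and c01: "continuous_on U g01" and c10: "continuous_on U g10"
  shows "g01 p = g10 p"
proof -
  have D: "((\<lambda>q. f q \<bullet> w) has_derivative (\<lambda>h. fst h *\<^sub>R (fa q \<bullet> w) + snd h *\<^sub>R (fb q \<bullet> w))) (at q)"
    if "(f has_derivative (\<lambda>h. fst h *\<^sub>R fa q + snd h *\<^sub>R fb q)) (at q)"
    for f fa fb :: "real \<times> real \<Rightarrow> 'a" and q and w :: 'a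
    using has_derivative_inner_left[OF that, of w] by (simp add: inner_add_left)
  have "g01 p \<bullet> w = g10 p \<bullet> w" for w
    using c01 c10 D g g0 g1
    by (intro mixed_partials_eq_real[OF assms(1,2), where ?g = "\<lambda>q. g q \<bullet> w"
          and ?g0.0 = "\<lambda>q. g0 q \<bullet> w" and ?g1.0 = "\<lambda>q. g1 q \<bullet> w"
          and ?g01.0 = "\<lambda>q. g01 q \<bullet> w" and ?g10.0 = "\<lambda>q. g10 q \<bullet> w"
          and ?g00.0 = "\<lambda>q. g00 q \<bullet> w" and ?g11.0 = "\<lambda>q. g11 q \<bullet> w"])
       (auto intro!: continuous_intros)
  then show ?thesis by (metis inner_commute vector_eq_rdot)
qed

section \<open>Second-order conditions at an interior minimum\<close>

lemma second_derivative_nonneg_at_min: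
  fixes g g' :: "real \<Rightarrow> real"
  assumes d: "0 < d"
    and g: "\<And>t. \<bar>t\<bar> < d \<Longrightarrow> (g has_real_derivative g' t) (at t)"
    and g': "(g' has_real_derivative c) (at 0)"
    and min: "\<And>t. \<bar>t\<bar> < d \<Longrightarrow> g 0 \<le> g t"
  shows "0 \<le> c"
proof (rule ccontr)
  assume "\<not> 0 \<le> c"
  then have c: "c < 0" by simp
  have z: "g' 0 = 0"
    using DERIV_local_min[OF g[of 0] d] d min by auto
  obtain e where e: "e > 0" "\<And>h. 0 < h \<Longrightarrow> h < e \<Longrightarrow> g' (0 + h) < g' 0"
    using DERIV_neg_dec_right[OF g' c] by auto
  define h where "h = min e d / 2"
  have h: "0 < h" "h < e" "h < d" using e d by (auto simp: h_def)
  have "g h < g 0"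
  proof (rule DERIV_neg_imp_decreasing_open[OF h(1)])
    show "\<exists>y. DERIV g t :> y \<and> y < 0" if "0 < t" "t < h" for t
      using g[of t] e(2)[of t] z that h by auto
    show "continuous_on {0..h} g"
      using g h by (intro continuous_at_imp_continuous_on ballI DERIV_isCont[of g "g' t" t for t]) auto
  qed
  with min[of h] h show False by auto
qed

text \<open>Restriction to each line through \<open>p\<close> reduces this to one variable. The
  mixed coefficients \<open>F01\<close> and \<open>F10\<close> stay separate because only their sum
  enters, so their symmetry need not be supplied.\<close>

lemma gradient_and_hessian_at_min:
  fixes F :: "real \<times> real \<Rightarrow> real"
  assumes r: "0 < r"
    and F: "\<And>q. q \<in> ball p r \<Longrightarrow> (F has_derivative (\<lambda>h. fst h *\<^sub>R F0 q + snd h *\<^sub>R F1 q)) (at q)"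
    and F0: "(F0 has_derivative (\<lambda>h. fst h *\<^sub>R F00 + snd h *\<^sub>R F01)) (at p)"
    and F1: "(F1 has_derivative (\<lambda>h. fst h *\<^sub>R F10 + snd h *\<^sub>R F11)) (at p)"
    and min: "\<And>q. q \<in> ball p r \<Longrightarrow> F p \<le> F q"
  shows "F0 p = 0" "F1 p = 0"
    and "0 \<le> u * u * F00 + u * v * F01 + v * u * F10 + v * v * F11"
proof -
  have line: "0 \<le> fst w * (fst w * F00 + snd w * F01) + snd w * (fst w * F10 + snd w * F11)
      \<and> fst w * F0 p + snd w * F1 p = 0" for w :: "real \<times> real"
  proof -
    \<comment> \<open>The summand 1 keeps the quotient meaningful for \<open>w = 0\<close>.\<close>
    define d where "d = r / (1 + norm w)"
    have n: "0 < 1 + norm w" by (smt (verit) norm_ge_zero)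
    have d: "d > 0" using r n by (simp add: d_def)
    have in_ball: "p + t *\<^sub>R w \<in> ball p r" if "\<bar>t\<bar> < d" for t
    proof -
      have "\<bar>t\<bar> * norm w \<le> \<bar>t\<bar> * (1 + norm w)" by (intro mult_left_mono) auto
      also have "\<dots> < d * (1 + norm w)" using that n by (intro mult_strict_right_mono)
      also have "\<dots> = r" using n by (simp add: d_def)
      finally show ?thesis by (simp add: dist_norm)
    qed
    let ?g = "\<lambda>t. F (p + t *\<^sub>R w)"
    let ?g' = "\<lambda>t. fst w * F0 (p + t *\<^sub>R w) + snd w * F1 (p + t *\<^sub>R w)"
    have g: "(?g has_real_derivative ?g' t) (at t)" if "\<bar>t\<bar> < d" for t
      by (rule differentiable_along_line[OF F[OF in_ball[OF that]]])
    have p0: "p + 0 *\<^sub>R w = p" by simp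
    have "((\<lambda>t. F0 (p + t *\<^sub>R w)) has_real_derivative (fst w * F00 + snd w * F01)) (at 0)"
      "((\<lambda>t. F1 (p + t *\<^sub>R w)) has_real_derivative (fst w * F10 + snd w * F11)) (at 0)"
      by (rule differentiable_along_line, unfold p0, fact F0 F1)+
    then have g': "(?g' has_real_derivative
        (fst w * (fst w * F00 + snd w * F01) + snd w * (fst w * F10 + snd w * F11))) (at 0)"
      by (intro DERIV_add DERIV_cmult)
    have gmin: "?g 0 \<le> ?g t" if "\<bar>t\<bar> < d" for t
      using min[OF in_ball[OF that]] by simp
    have "?g' 0 = 0"
      using DERIV_local_min[OF g[of 0] d] d gmin by auto
    with second_derivative_nonneg_at_min[OF d g g' gmin] show ?thesis
      unfolding p0 by blast
  qed
  show "F0 p = 0" using line[of "(1, 0)"] by simp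
  show "F1 p = 0" using line[of "(0, 1)"] by simp
  show "0 \<le> u * u * F00 + u * v * F01 + v * u * F10 + v * v * F11"
    using line[of "(u, v)"] by (simp add: algebra_simps)
qed

section \<open>A strong minimum principle\<close>

text \<open>Multiplied by \<open>a00\<close>, the trace becomes the form \<open>h\<close> evaluated
  at \<open>(a00, a01)\<close> plus the determinant of the \<open>a\<close>-matrix times
  \<open>h11\<close>.\<close>

lemma trace_product_nonneg:
  fixes a00 a01 a11 h00 h01 h10 h11 :: real
  assumes a: "0 < a00" "0 < a00 * a11 - a01 * a01"
    and h: "\<And>u v. 0 \<le> u * u * h00 + u * v * h01 + v * u * h10 + v * v * h11"
  shows "0 \<le> a00 * h00 + a01 * h01 + a01 * h10 + a11 * h11"
proof -
  have h11: "0 \<le> h11" using h[of 0 1] by simp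
  have "0 \<le> a00 * a00 * h00 + a00 * a01 * h01 + a01 * a00 * h10 + a01 * a01 * h11"
    by (rule h)
  moreover have "0 \<le> (a00 * a11 - a01 * a01) * h11" using a h11 by simp
  ultimately have "0 \<le> a00 * (a00 * h00 + a01 * h01 + a01 * h10 + a11 * h11)"
    by (simp add: algebra_simps)
  with a(1) show ?thesis by (simp add: zero_le_mult_iff)
qed

text \<open>Multiplying by \<open>a00\<close> and completing the square leaves the determinant as
  the coefficient of the square of \<open>v\<close>.\<close>

lemma quadratic_form_pos:
  fixes a00 a01 a11 u v :: real
  assumes a: "0 < a00" "0 < a00 * a11 - a01 * a01" and uv: "u \<noteq> 0 \<or> v \<noteq> 0"
  shows "0 < a00 * u * u + 2 * a01 * u * v + a11 * v * v"
proof -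
  have "0 < (a00 * u + a01 * v)\<^sup>2 + (a00 * a11 - a01 * a01) * v\<^sup>2"
  proof (cases "v = 0")
    case True with uv a show ?thesis by simp
  next
    case False
    then show ?thesis using a by (intro add_nonneg_pos mult_pos_pos) auto
  qed
  also have "\<dots> = a00 * (a00 * u * u + 2 * a01 * u * v + a11 * v * v)"
    by (simp add: power2_eq_square algebra_simps)
  finally show ?thesis using a(1) by (simp add: zero_less_mult_iff)
qed

text \<open>The ball with diameter from \<open>y\<close> to \<open>z\<close> touches the sphere
  about \<open>y\<close> through \<open>z\<close> only at \<open>z\<close>. By the parallelogram
  law, any other contact point would still satisfy \<open>a = c\<close>, which says that it is
  \<open>z\<close>. This supplies a closed ball with a single zero on it.\<close>

lemma in_half_ball_dist:
  fixes y z q :: "'a::real_inner"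
  assumes "dist q (midpoint y z) \<le> dist y z / 2" "q \<noteq> z"
  shows "dist q y < dist y z"
proof (rule ccontr)
  assume "\<not> dist q y < dist y z"
  then have far: "dist y z \<le> dist q y" by simp
  define a where "a = q - midpoint y z"
  define c where "c = midpoint y z - y"
  have c: "norm c = dist y z / 2"
    by (metis c_def dist_commute dist_midpoint(1) dist_norm)
  have zc: "z = midpoint y z + c"
    using midpoint_plus_self[of y z] by (simp add: c_def algebra_simps)
  have "(norm (a + c))\<^sup>2 + (norm (a - c))\<^sup>2 = 2 * (norm a)\<^sup>2 + 2 * (norm c)\<^sup>2"
    by (simp add: power2_norm_eq_inner algebra_simps inner_commute)
  moreover have "(norm a)\<^sup>2 \<le> (norm c)\<^sup>2"
    using assms(1) by (intro power_mono) (auto simp: a_def c dist_norm)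
  moreover have "(2 * norm c)\<^sup>2 \<le> (norm (a + c))\<^sup>2"
    using far c by (intro power_mono) (auto simp: a_def c_def dist_norm)
  ultimately have "(norm (a - c))\<^sup>2 \<le> 0" by (simp add: power2_eq_square)
  then have "a = c" by simp
  then have "q = z" using zc unfolding a_def by (metis add.commute diff_add_cancel)
  with assms(2) show False by simp
qed

section \<open>Supersolutions and the Hopf barrier\<close>

definition barrier :: "real \<Rightarrow> real \<times> real \<Rightarrow> real \<times> real \<Rightarrow> real" where
  "barrier k y q = exp (- k * ((fst q - fst y)\<^sup>2 + (snd q - snd y)\<^sup>2))"

lemma barrier_dist: "barrier k y q = exp (- k * (dist q y)\<^sup>2)"
  by (simp add: barrier_def dist_prod_def dist_real_def)

lemma barrier_derivatives:
  "(barrier k y has_derivative (\<lambda>h. fst h *\<^sub>R (- 2 * k * (fst q - fst y) * barrier k y q)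
      + snd h *\<^sub>R (- 2 * k * (snd q - snd y) * barrier k y q))) (at q)"
  "((\<lambda>q. - 2 * k * (fst q - fst y) * barrier k y q) has_derivative
      (\<lambda>h. fst h *\<^sub>R ((4 * k\<^sup>2 * (fst q - fst y) * (fst q - fst y) - 2 * k) * barrier k y q)
      + snd h *\<^sub>R (4 * k\<^sup>2 * (fst q - fst y) * (snd q - snd y) * barrier k y q))) (at q)"
  "((\<lambda>q. - 2 * k * (snd q - snd y) * barrier k y q) has_derivative
      (\<lambda>h. fst h *\<^sub>R (4 * k\<^sup>2 * (fst q - fst y) * (snd q - snd y) * barrier k y q)
      + snd h *\<^sub>R ((4 * k\<^sup>2 * (snd q - snd y) * (snd q - snd y) - 2 * k) * barrier k y q))) (at q)"
proof -
  show D: "(barrier k y has_derivative (\<lambda>h. fst h *\<^sub>R (- 2 * k * (fst q - fst y) * barrier k y q)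
      + snd h *\<^sub>R (- 2 * k * (snd q - snd y) * barrier k y q))) (at q)" for q
    unfolding barrier_def[abs_def]
    by (rule has_derivative_eq_rhs, (rule derivative_intros)+)
       (auto simp: fun_eq_iff algebra_simps power2_eq_square)
  show "((\<lambda>q. - 2 * k * (fst q - fst y) * barrier k y q) has_derivative
      (\<lambda>h. fst h *\<^sub>R ((4 * k\<^sup>2 * (fst q - fst y) * (fst q - fst y) - 2 * k) * barrier k y q)
      + snd h *\<^sub>R (4 * k\<^sup>2 * (fst q - fst y) * (snd q - snd y) * barrier k y q))) (at q)"
    by (rule has_derivative_eq_rhs, (rule derivative_intros D)+)
       (auto simp: fun_eq_iff algebra_simps power2_eq_square)
  show "((\<lambda>q. - 2 * k * (snd q - snd y) * barrier k y q) has_derivative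
      (\<lambda>h. fst h *\<^sub>R (4 * k\<^sup>2 * (fst q - fst y) * (snd q - snd y) * barrier k y q)
      + snd h *\<^sub>R ((4 * k\<^sup>2 * (snd q - snd y) * (snd q - snd y) - 2 * k) * barrier k y q))) (at q)"
    by (rule has_derivative_eq_rhs, (rule derivative_intros D)+)
       (auto simp: fun_eq_iff algebra_simps power2_eq_square)
qed

text \<open>The operator \<open>L\<close> has the symmetric principal part with entries
  \<open>a00\<close>, \<open>a01\<close>, \<open>a11\<close>, a drift, and no zeroth-order term, so
  adding a constant to a comparison function does not change its image under \<open>L\<close>. The
  intended \<open>v\<close> is \<open>1 - |x|^2 / 2\<close>.\<close>

locale supersolution =
  fixes U :: "(real \<times> real) set"
    and v v0 v1 v00 v01 v10 v11 a00 a01 a11 b0 b1 :: "real \<times> real \<Rightarrow> real"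
  assumes U: "open U"
    and v: "\<And>q. q \<in> U \<Longrightarrow> (v has_derivative (\<lambda>h. fst h *\<^sub>R v0 q + snd h *\<^sub>R v1 q)) (at q)"
    and v0: "\<And>q. q \<in> U \<Longrightarrow> (v0 has_derivative (\<lambda>h. fst h *\<^sub>R v00 q + snd h *\<^sub>R v01 q)) (at q)"
    and v1: "\<And>q. q \<in> U \<Longrightarrow> (v1 has_derivative (\<lambda>h. fst h *\<^sub>R v10 q + snd h *\<^sub>R v11 q)) (at q)"
    and nonneg: "\<And>q. q \<in> U \<Longrightarrow> 0 \<le> v q"
    and coeffs: "continuous_on U a00" "continuous_on U a01" "continuous_on U a11"
      "continuous_on U b0" "continuous_on U b1"
    and elliptic: "\<And>q. q \<in> U \<Longrightarrow> 0 < a00 q" "\<And>q. q \<in> U \<Longrightarrow> 0 < a00 q * a11 q - a01 q * a01 q"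
    and super: "\<And>q. q \<in> U \<Longrightarrow>
      a00 q * v00 q + a01 q * v01 q + a01 q * v10 q + a11 q * v11 q + b0 q * v0 q + b1 q * v1 q \<le> 0"
begin

lemma continuous_v: "continuous_on U v"
  by (intro continuous_at_imp_continuous_on ballI has_derivative_continuous[OF v])

text \<open>The displayed expression is \<open>L\<close> applied to the barrier, with the positive
  exponential divided out. It equals \<open>2 k (2 k Q - B)\<close>, where \<open>Q\<close> is the
  principal form evaluated at \<open>q - y\<close>, and \<open>B\<close> collects the trace and the
  drift. Compactness and \<open>y\<close> lying outside \<open>K\<close> bound \<open>Q\<close>
  below by a positive number, so a large \<open>k\<close> wins.\<close>

lemma barrier_subsolution:
  assumes K: "compact K" "K \<subseteq> U" "y \<notin> K"
  obtains k where "0 < k" and "\<And>q. q \<in> K \<Longrightarrow>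
     0 < a00 q * (4 * k\<^sup>2 * (fst q - fst y) * (fst q - fst y) - 2 * k)
       + 2 * a01 q * (4 * k\<^sup>2 * (fst q - fst y) * (snd q - snd y))
       + a11 q * (4 * k\<^sup>2 * (snd q - snd y) * (snd q - snd y) - 2 * k)
       + b0 q * (- 2 * k * (fst q - fst y)) + b1 q * (- 2 * k * (snd q - snd y))"
proof (cases "K = {}")
  case True
  then show ?thesis using that[of 1] by simp
next
  case False
  let ?Q = "\<lambda>q. a00 q * (fst q - fst y) * (fst q - fst y) + 2 * a01 q * (fst q - fst y) * (snd q - snd y)
      + a11 q * (snd q - snd y) * (snd q - snd y)"
  let ?B = "\<lambda>q. a00 q + a11 q + b0 q * (fst q - fst y) + b1 q * (snd q - snd y)"
  have cK: "continuous_on K a00" "continuous_on K a01" "continuous_on K a11"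
      "continuous_on K b0" "continuous_on K b1"
    using coeffs K continuous_on_subset by blast+
  have "continuous_on K ?Q" "continuous_on K ?B"
    by (intro continuous_intros cK)+
  note cQB = this
  obtain q1 where q1: "q1 \<in> K" "\<And>q. q \<in> K \<Longrightarrow> ?Q q1 \<le> ?Q q"
    using continuous_attains_inf[OF K(1) False cQB(1)] by blast
  obtain q2 where q2: "q2 \<in> K" "\<And>q. q \<in> K \<Longrightarrow> ?B q \<le> ?B q2"
    using continuous_attains_sup[OF K(1) False cQB(2)] by blast
  have c: "0 < ?Q q1"
  proof (rule quadratic_form_pos)
    have "q1 \<noteq> y" using q1(1) K(3) by blast
    then show "fst q1 - fst y \<noteq> 0 \<or> snd q1 - snd y \<noteq> 0" by (auto simp: prod_eq_iff)
    have "q1 \<in> U" using q1(1) K(2) by blast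
    then show "0 < a00 q1" "0 < a00 q1 * a11 q1 - a01 q1 * a01 q1" by (rule elliptic)+
  qed
  \<comment> \<open>This makes \<open>k * Q\<close> exceed \<open>B\<close> everywhere on
    \<open>K\<close>; the extra 1 gives strictness.\<close>
  define k where "k = (\<bar>?B q2\<bar> + 1) / ?Q q1"
  have k: "0 < k" using c by (simp add: k_def)
  show ?thesis
  proof (rule that[OF k])
    fix q assume q: "q \<in> K"
    have "?B q < \<bar>?B q2\<bar> + 1" using q2(2)[OF q] by linarith
    also have "\<dots> = k * ?Q q1" using c by (simp add: k_def)
    also have "\<dots> \<le> k * ?Q q" using q1(2)[OF q] k by (intro mult_left_mono) auto
    finally have B: "0 < k * ?Q q - ?B q" by simp
    have "0 < 2 * k * (2 * (k * ?Q q) - ?B q)"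
    proof -
      have "0 \<le> k * ?Q q"
        using \<open>k * ?Q q1 \<le> k * ?Q q\<close> k c by (smt (verit) mult_pos_pos)
      with B have "0 < 2 * (k * ?Q q) - ?B q" by linarith
      with k show ?thesis by (intro mult_pos_pos) auto
    qed
    then show "0 < a00 q * (4 * k\<^sup>2 * (fst q - fst y) * (fst q - fst y) - 2 * k)
       + 2 * a01 q * (4 * k\<^sup>2 * (fst q - fst y) * (snd q - snd y))
       + a11 q * (4 * k\<^sup>2 * (snd q - snd y) * (snd q - snd y) - 2 * k)
       + b0 q * (- 2 * k * (fst q - fst y)) + b1 q * (- 2 * k * (snd q - snd y))"
      by (simp add: algebra_simps power2_eq_square)
  qed
qed

text \<open>Hopf's argument: near a zero \<open>z\<close> on the boundary of a ball in which \<open>v > 0\<close>, a small multiple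
  of the barrier touches \<open>v\<close> from below at an interior point, where \<open>L v > 0\<close> would follow.\<close>

lemma no_boundary_zero:
  assumes z: "z \<in> U" "v z = 0" and y: "y \<noteq> z" "cball y (dist y z) \<subseteq> U"
    and pos: "\<And>q. q \<in> cball y (dist y z) \<Longrightarrow> q \<noteq> z \<Longrightarrow> 0 < v q"
  shows False
proof -
  define R where "R = dist y z"
  have R: "R > 0" using y by (simp add: R_def)
  obtain e where e: "e > 0" "cball z e \<subseteq> U"
    using U z(1) open_contains_cball by blast
  \<comment> \<open>The bound by \<open>R / 2\<close> keeps the centre \<open>y\<close> outside
    \<open>cball z n\<close>, as the barrier estimate requires.\<close>
  define n where "n = min e (R / 2)"
  have n: "n > 0" "cball z n \<subseteq> U" "n < R" using e R by (auto simp: n_def)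
  have "y \<notin> cball z n" using n(3) by (auto simp: R_def dist_commute)
  then obtain k where k: "0 < k" and Lw: "\<And>q. q \<in> cball z n \<Longrightarrow>
     0 < a00 q * (4 * k\<^sup>2 * (fst q - fst y) * (fst q - fst y) - 2 * k)
       + 2 * a01 q * (4 * k\<^sup>2 * (fst q - fst y) * (snd q - snd y))
       + a11 q * (4 * k\<^sup>2 * (snd q - snd y) * (snd q - snd y) - 2 * k)
       + b0 q * (- 2 * k * (fst q - fst y)) + b1 q * (- 2 * k * (snd q - snd y))"
    using barrier_subsolution[OF compact_cball n(2)] by blast
  let ?w = "\<lambda>q. barrier k y q - exp (- k * R\<^sup>2)"
  \<comment> \<open>The small sphere is split: on \<open>S\<close> compactness gives
    \<open>v\<close> a positive lower bound, since \<open>z\<close> is not on the sphere; off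
    \<open>S\<close> the function \<open>?w\<close> is already negative.\<close>
  define S where "S = sphere z n \<inter> cball y R"
  have S: "compact S" unfolding S_def by (intro compact_Int_closed) auto
  obtain m where m: "m > 0" "\<And>q. q \<in> S \<Longrightarrow> m \<le> v q"
  proof (cases "S = {}")
    case True then show ?thesis using that[of 1] by simp
  next
    case False
    have "continuous_on S v"
      using n(2) by (intro continuous_on_subset[OF continuous_v]) (auto simp: S_def)
    then obtain q1 where q1: "q1 \<in> S" "\<And>q. q \<in> S \<Longrightarrow> v q1 \<le> v q"
      using continuous_attains_inf[OF S False] by blast
    have "0 < v q1" using q1(1) n(1) by (intro pos) (auto simp: S_def R_def)
    with q1 show ?thesis using that by blast
  qed
  \<comment> \<open>Since \<open>?w < 1\<close>, subtracting \<open>\<epsilon> * ?w\<close> costs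
    less than half of the lower bound \<open>m\<close>.\<close>
  define \<epsilon> where "\<epsilon> = m / 2"
  have \<epsilon>: "\<epsilon> > 0" using m by (simp add: \<epsilon>_def)
  let ?F = "\<lambda>q. v q - \<epsilon> * ?w q"
  have w_out: "?w q < 0" if "dist q y > R" for q
  proof -
    have "R\<^sup>2 < (dist q y)\<^sup>2" using that R power_strict_mono[of R "dist q y" 2] by simp
    then show ?thesis using k by (simp add: barrier_dist)
  qed
  have w_le: "?w q < 1" for q
  proof -
    have "barrier k y q \<le> 1" using k by (simp add: barrier_dist)
    then show ?thesis by (smt (verit) exp_gt_zero)
  qed
  have bd: "0 < ?F q" if "q \<in> sphere z n" for q
  proof (cases "dist q y \<le> R")
    case True
    then have "q \<in> S" using that by (simp add: S_def dist_commute)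
    then have "m \<le> v q" by (rule m)
    moreover have "\<epsilon> * ?w q < \<epsilon> * 1" using w_le \<epsilon> by (intro mult_strict_left_mono)
    ultimately show ?thesis using m(1) unfolding \<epsilon>_def by linarith
  next
    case False
    then have "\<epsilon> * ?w q < 0" using w_out \<epsilon> by (simp add: mult_pos_neg)
    moreover have "0 \<le> v q" using that n(2) by (intro nonneg) auto
    ultimately show ?thesis by linarith
  qed
  have Fz: "?F z = 0" using z by (simp add: barrier_dist R_def dist_commute)
  have FD: "(?F has_derivative (\<lambda>h. fst h *\<^sub>R (v0 q - \<epsilon> * (- 2 * k * (fst q - fst y) * barrier k y q))
      + snd h *\<^sub>R (v1 q - \<epsilon> * (- 2 * k * (snd q - snd y) * barrier k y q)))) (at q)" if "q \<in> U" for q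
    by (rule has_derivative_eq_rhs, (rule derivative_intros v[OF that] barrier_derivatives)+)
       (simp add: fun_eq_iff algebra_simps)
  have "continuous_on (cball z n) ?F"
    by (intro continuous_at_imp_continuous_on ballI has_derivative_continuous[OF FD] subsetD[OF n(2)])
  then obtain p where p: "p \<in> cball z n" "\<And>q. q \<in> cball z n \<Longrightarrow> ?F p \<le> ?F q"
    using continuous_attains_inf[OF compact_cball, of z n ?F] n(1) by auto
  \<comment> \<open>The minimum over the closed ball is at most the value 0 at the centre
    \<open>z\<close>, whereas \<open>?F\<close> is positive on the bounding sphere; hence it is
    attained in the interior.\<close>
  have "?F p \<le> 0" using p(2)[of z] Fz n(1) by simp
  then have "p \<notin> sphere z n" using bd[of p] by linarith
  then have pb: "p \<in> ball z n" using p(1) by auto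
  then obtain r where r: "r > 0" "ball p r \<subseteq> ball z n" using openE open_ball by blast
  have rU: "ball p r \<subseteq> U" using r(2) n(2) ball_subset_cball by blast
  then have pU: "p \<in> U" using r(1) by auto
  let ?E = "barrier k y p"
  let ?d0 = "fst p - fst y" and ?d1 = "snd p - snd y"
  have F0D: "((\<lambda>q. v0 q - \<epsilon> * (- 2 * k * (fst q - fst y) * barrier k y q)) has_derivative
     (\<lambda>h. fst h *\<^sub>R (v00 p - \<epsilon> * ((4 * k\<^sup>2 * ?d0 * ?d0 - 2 * k) * ?E))
        + snd h *\<^sub>R (v01 p - \<epsilon> * (4 * k\<^sup>2 * ?d0 * ?d1 * ?E)))) (at p)"
    by (rule has_derivative_eq_rhs, rule has_derivative_diff[OF v0[OF pU] 
          has_derivative_mult_right[OF barrier_derivatives(2)]])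
       (simp add: fun_eq_iff algebra_simps)
  have F1D: "((\<lambda>q. v1 q - \<epsilon> * (- 2 * k * (snd q - snd y) * barrier k y q)) has_derivative
     (\<lambda>h. fst h *\<^sub>R (v10 p - \<epsilon> * (4 * k\<^sup>2 * ?d0 * ?d1 * ?E))
        + snd h *\<^sub>R (v11 p - \<epsilon> * ((4 * k\<^sup>2 * ?d1 * ?d1 - 2 * k) * ?E)))) (at p)"
    by (rule has_derivative_eq_rhs, rule has_derivative_diff[OF v1[OF pU] 
          has_derivative_mult_right[OF barrier_derivatives(3)]])
       (simp add: fun_eq_iff algebra_simps)
  have minF: "?F p \<le> ?F q" if "q \<in> ball p r" for q
    using that r(2) ball_subset_cball by (intro p(2)) blast
  \<comment> \<open>Criticality of \<open>p\<close> trades the first derivatives of \<open>v\<close>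
    for those of the barrier, so the drift can be added to the Hessian inequality and the full
    operator appears.\<close>
  note mm = gradient_and_hessian_at_min[where F = ?F,
      OF r(1) FD[OF subsetD[OF rU]] F0D F1D minF]
  have g0: "v0 p = \<epsilon> * (- 2 * k * ?d0 * ?E)" and g1: "v1 p = \<epsilon> * (- 2 * k * ?d1 * ?E)"
    using mm(1,2) by auto
  have "0 \<le> a00 p * (v00 p - \<epsilon> * ((4 * k\<^sup>2 * ?d0 * ?d0 - 2 * k) * ?E))
      + a01 p * (v01 p - \<epsilon> * (4 * k\<^sup>2 * ?d0 * ?d1 * ?E))
      + a01 p * (v10 p - \<epsilon> * (4 * k\<^sup>2 * ?d0 * ?d1 * ?E))
      + a11 p * (v11 p - \<epsilon> * ((4 * k\<^sup>2 * ?d1 * ?d1 - 2 * k) * ?E))"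
    by (rule trace_product_nonneg[OF elliptic[OF pU] mm(3)])
  also have "\<dots> = (a00 p * v00 p + a01 p * v01 p + a01 p * v10 p + a11 p * v11 p + b0 p * v0 p + b1 p * v1 p)
      - \<epsilon> * ?E * (a00 p * (4 * k\<^sup>2 * ?d0 * ?d0 - 2 * k) + 2 * a01 p * (4 * k\<^sup>2 * ?d0 * ?d1)
       + a11 p * (4 * k\<^sup>2 * ?d1 * ?d1 - 2 * k) + b0 p * (- 2 * k * ?d0) + b1 p * (- 2 * k * ?d1))"
    by (simp add: g0 g1 algebra_simps)
  also have "\<dots> < 0"
  proof -
    have "0 < \<epsilon> * ?E" using \<epsilon> by (simp add: barrier_def)
    from this Lw[OF p(1)] have "0 < \<epsilon> * ?E * (a00 p * (4 * k\<^sup>2 * ?d0 * ?d0 - 2 * k) + 2 * a01 p * (4 * k\<^sup>2 * ?d0 * ?d1)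
       + a11 p * (4 * k\<^sup>2 * ?d1 * ?d1 - 2 * k) + b0 p * (- 2 * k * ?d0) + b1 p * (- 2 * k * ?d1))"
      by (rule mult_pos_pos)
    with super[OF pU] show ?thesis by linarith
  qed
  finally show False by simp
qed

text \<open>For a nearby \<open>y\<close> with \<open>v y\<close> nonzero, a nearest zero
  \<open>z\<close> lies on the boundary of a zero-free ball about \<open>y\<close>. Passing to the
  ball with diameter from \<open>y\<close> to \<open>z\<close> leaves \<open>z\<close> as the only
  zero on the closed ball, contrary to \<open>no_boundary_zero\<close>. The conclusion is local,
  ready for an open-closed argument on the surface.\<close>

theorem strong_minimum_principle:
  assumes p: "p \<in> U" "v p = 0"
  shows "\<exists>r>0. ball p r \<subseteq> U \<and> (\<forall>q\<in>ball p r. v q = 0)"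
proof -
  obtain e where e: "e > 0" "cball p e \<subseteq> U"
    using U p(1) open_contains_cball by blast
  \<comment> \<open>With \<open>dist y p\<close> and \<open>dist y z\<close> both below
    \<open>e / 3\<close>, the ball having \<open>y\<close> and \<open>z\<close> as opposite points
    stays within \<open>2 * e / 3\<close> of \<open>p\<close>.\<close>
  have "v y = 0" if y: "y \<in> ball p (e / 3)" for y
  proof (rule ccontr)
    assume vy: "v y \<noteq> 0"
    \<comment> \<open>Restricting to the compact ball makes the zero set closed. The auxiliary ball
      stays in \<open>cball p e\<close>, so zeros elsewhere cannot interfere.\<close>
    define Z where "Z = {q \<in> cball p e. v q = 0}"
    have "continuous_on (cball p e) v" using continuous_v e(2) continuous_on_subset by blast
    then have Z: "closed Z" unfolding Z_def
      using continuous_closed_preimage_constant[of "cball p e" v 0] by auto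
    moreover have pZ: "p \<in> Z" using p e by (simp add: Z_def)
    ultimately obtain z where z: "z \<in> Z" "\<And>q. q \<in> Z \<Longrightarrow> dist y z \<le> dist y q"
      using distance_attains_inf[of Z y] by blast
    have yp: "dist y z < e / 3" using z(2)[OF pZ] y by (simp add: dist_commute)
    have yz: "y \<noteq> z" using z(1) vy by (auto simp: Z_def)
    define y' where "y' = midpoint y z"
    have d': "dist y' z = dist y z / 2" by (simp add: y'_def dist_midpoint)
    have sub: "cball y' (dist y' z) \<subseteq> cball p e"
    proof
      fix q assume "q \<in> cball y' (dist y' z)"
      then have "dist q y' \<le> dist y z / 2" by (simp add: d' dist_commute)
      moreover have "dist y' y = dist y z / 2" by (simp add: y'_def dist_midpoint)
      moreover have "dist y p < e / 3" using y by (simp add: dist_commute)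
      moreover have "dist q p \<le> dist q y' + dist y' y + dist y p" by (smt (verit) dist_triangle)
      ultimately show "q \<in> cball p e" using yp e(1) by (simp add: dist_commute)
    qed
    show False
    proof (rule no_boundary_zero[of z y'])
      show "z \<in> U" "v z = 0" using z(1) e(2) by (auto simp: Z_def)
      show "y' \<noteq> z" using d' yz by auto
      show "cball y' (dist y' z) \<subseteq> U" using sub e(2) by blast
      show "0 < v q" if "q \<in> cball y' (dist y' z)" "q \<noteq> z" for q
      proof -
        have "dist q y < dist y z"
          using that d' by (intro in_half_ball_dist) (auto simp: y'_def dist_commute)
        then have "q \<notin> Z" using z(2)[of q] by (auto simp: dist_commute)
        then have "v q \<noteq> 0" using that sub by (auto simp: Z_def)
        moreover have "0 \<le> v q" using that sub e(2) by (intro nonneg) auto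
        ultimately show ?thesis by simp
      qed
    qed
  qed
  moreover have "ball p (e / 3) \<subseteq> U"
    using e ball_subset_cball subset_ball[of "e / 3" e p] by force
  moreover have "0 < e / 3" using e(1) by simp
  ultimately show ?thesis by blast
qed

end

section \<open>Lagrangian tangent frames\<close>

lemma cJ_linear: "bounded_linear cJ"
  unfolding cJ_def[abs_def]
  by (intro bounded_linear_Pair bounded_linear_compose[OF bounded_linear_mult_right]
      bounded_linear_fst bounded_linear_snd)

lemmas cJ_add = linear_add[OF bounded_linear.linear[OF cJ_linear]]
  and cJ_diff = linear_diff[OF bounded_linear.linear[OF cJ_linear]]
  and cJ_scale = linear_cmul[OF bounded_linear.linear[OF cJ_linear]]
  and cJ_minus = linear_neg[OF bounded_linear.linear[OF cJ_linear]]

lemma cJ_cJ [simp]: "cJ (cJ v) = - v"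
  by (simp add: cJ_def prod_eq_iff flip: mult.assoc)

lemma inner_cJ_cJ [simp]: "cJ v \<bullet> cJ w = v \<bullet> w"
  by (simp add: cJ_def inner_prod_def inner_complex_def)

lemma inner_cJ_left: "cJ v \<bullet> w = - (v \<bullet> cJ w)"
  by (simp add: cJ_def inner_prod_def inner_complex_def)

lemma inner_cJ_self [simp]: "v \<bullet> cJ v = 0" "cJ v \<bullet> v = 0"
  by (simp_all add: cJ_def inner_prod_def inner_complex_def)

lemma norm_cJ [simp]: "norm (cJ v) = norm v"
  by (simp add: norm_eq_sqrt_inner)

text \<open>The hypotheses say that \<open>e1\<close>, \<open>e2\<close> is a unitary basis, and
  adding \<open>J e1\<close>, \<open>J e2\<close> gives four orthonormal vectors in a real space of
  dimension 4. It serves both for tangent frames and for the fixed frame that defines the final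
  isometry.\<close>

lemma lagrangian_frame_expand:
  fixes e1 e2 v :: "complex \<times> complex"
  assumes "norm e1 = 1" "norm e2 = 1" "e1 \<bullet> e2 = 0" "e1 \<bullet> cJ e2 = 0"
  shows "v = (v \<bullet> e1) *\<^sub>R e1 + (v \<bullet> e2) *\<^sub>R e2 + (v \<bullet> cJ e1) *\<^sub>R cJ e1 + (v \<bullet> cJ e2) *\<^sub>R cJ e2"
proof -
  have u: "e1 \<bullet> e1 = 1" "e2 \<bullet> e2 = 1" using assms(1,2) by (simp_all add: norm_eq_1)
  have z: "e2 \<bullet> e1 = 0" "cJ e2 \<bullet> e1 = 0" "e2 \<bullet> cJ e1 = 0" "cJ e1 \<bullet> e2 = 0"
    using assms(3,4) inner_cJ_left[of e2 e1] inner_cJ_left[of e1 e2] by (simp_all add: inner_commute)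
  let ?B = "{e1, e2, cJ e1, cJ e2}"
  have ne: "e1 \<noteq> e2" "e1 \<noteq> cJ e1" "e1 \<noteq> cJ e2" "e2 \<noteq> cJ e1" "e2 \<noteq> cJ e2" "cJ e1 \<noteq> cJ e2"
    using u z assms inner_cJ_self[of e1] inner_cJ_self[of e2] inner_cJ_cJ[of e1 e2]
      inner_cJ_cJ[of e2 e1] inner_cJ_cJ[of e1 e1] inner_cJ_cJ[of e2 e2] by (auto simp del: inner_cJ_self inner_cJ_cJ)
  have orth: "pairwise orthogonal ?B"
    using z assms by (auto simp: pairwise_def orthogonal_def)
  have n1: "norm i = 1" if "i \<in> ?B" for i using that assms by auto
  have "0 \<notin> ?B"
    using n1[of 0] by (metis norm_zero zero_neq_one)
  then have "independent ?B" using orth pairwise_orthogonal_independent by blast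
  moreover have "card ?B = DIM(complex \<times> complex)" using ne by simp
  ultimately have "UNIV \<subseteq> span ?B"
    by (intro card_ge_dim_independent) auto
  then have "(\<Sum>i\<in>?B. (v \<bullet> i) *\<^sub>R i) = v"
    using orth n1 by (intro orthonormal_basis_expand) auto
  then show ?thesis using ne by (simp add: add.assoc)
qed

definition df :: "param \<Rightarrow> real \<times> real \<Rightarrow> real \<times> real \<Rightarrow> complex \<times> complex" where
  "df f q u = fst u *\<^sub>R tang f 0 q + snd u *\<^sub>R tang f 1 q"

definition d2f :: "param \<Rightarrow> real \<times> real \<Rightarrow> real \<times> real \<Rightarrow> real \<times> real \<Rightarrow> complex \<times> complex" where
  "d2f f q u v = (fst u * fst v) *\<^sub>R sec f 0 0 q + (fst u * snd v) *\<^sub>R sec f 0 1 q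
     + (snd u * fst v) *\<^sub>R sec f 1 0 q + (snd u * snd v) *\<^sub>R sec f 1 1 q"

text \<open>On a Lagrangian chart \<open>J\<close> of a tangent vector is normal, so the pairing
  kills the tangential part of \<open>d2f\<close>. This is therefore the form
  \<open><h(u,v), J w>\<close> without a normal projection.\<close>

definition cubic :: "param \<Rightarrow> real \<times> real \<Rightarrow> real \<times> real \<Rightarrow> real \<times> real \<Rightarrow> real \<times> real \<Rightarrow> real" where
  "cubic f q u v w = d2f f q u v \<bullet> cJ (df f q w)"

lemma df_linear: "df f q (a *\<^sub>R u + b *\<^sub>R v) = a *\<^sub>R df f q u + b *\<^sub>R df f q v"
  by (simp add: df_def algebra_simps)

locale lagrangian_chart =
  fixes f :: param and U :: "(real \<times> real) set"
  assumes open_U: "open U"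
    and C2: "Ck 2 U f"
    and immersion: "\<And>q. q \<in> U \<Longrightarrow> immersion_at f q"
    and lagrangian: "\<And>q. q \<in> U \<Longrightarrow> lagrangian_at f q"
begin

lemma has_derivative_f: "q \<in> U \<Longrightarrow> (f has_derivative df f q) (at q)"
  using has_derivative_pd[of f q] C2 by (simp add: df_def[abs_def] tang_def numeral_2_eq_2)

lemma Ck1_tang: "Ck 1 U (tang f i)"
  using C2 by (simp add: tang_def[abs_def] pd_def[abs_def] numeral_2_eq_2)

lemma has_derivative_tang:
  "q \<in> U \<Longrightarrow> (tang f i has_derivative (\<lambda>h. fst h *\<^sub>R sec f i 0 q + snd h *\<^sub>R sec f i 1 q)) (at q)"
  using has_derivative_pd[of "tang f i" q] Ck1_tang by (simp add: sec_def)

lemma continuous_sec: "continuous_on U (sec f i j)"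
  using Ck1_tang[of i] by (simp add: sec_def[abs_def] pd_def[abs_def])

lemma continuous_tang: "continuous_on U (tang f i)"
  by (intro continuous_at_imp_continuous_on ballI has_derivative_continuous[OF has_derivative_tang])

lemma continuous_f: "continuous_on U f"
  by (intro continuous_at_imp_continuous_on ballI has_derivative_continuous[OF has_derivative_f])

lemma sec_sym: "q \<in> U \<Longrightarrow> sec f 1 0 q = sec f 0 1 q"
  using mixed_partials_eq[OF open_U, of q f "tang f 0" "tang f 1" "sec f 0 0" "sec f 0 1" "sec f 1 0" "sec f 1 1"]
    has_derivative_f has_derivative_tang continuous_sec by (simp add: df_def[abs_def])

lemma detg_pos: "q \<in> U \<Longrightarrow> 0 < detg f q"
  using immersion by (simp add: immersion_at_def)

lemma tang_normal:
  assumes "q \<in> U" shows "tang f i q \<bullet> cJ (tang f j q) = 0"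
proof -
  have t: "tang f k q \<in> {tang f 0 q, tang f 1 q}" for k
    by (simp add: tang_def pd_def)
  have "cJ (tang f j q) \<in> cJ ` span {tang f 0 q, tang f 1 q}"
    using t by (intro imageI span_base)
  then have "cJ (tang f j q) \<bullet> tang f 0 q = 0 \<and> cJ (tang f j q) \<bullet> tang f 1 q = 0"
    using lagrangian[OF assms] by (simp add: lagrangian_at_def)
  with t[of i] show ?thesis by (auto simp: inner_commute)
qed

lemma df_normal: "q \<in> U \<Longrightarrow> df f q u \<bullet> cJ (df f q v) = 0"
  by (simp add: df_def cJ_add cJ_scale inner_add_left inner_add_right tang_normal)

text \<open>The symmetry in the outer indices is the derivative of the Lagrangian condition.\<close>

lemma sec_cJ_sym:
  assumes "q \<in> U" "j = 0 \<or> j = 1"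
  shows "sec f i j q \<bullet> cJ (tang f k q) = sec f k j q \<bullet> cJ (tang f i q)"
proof -
  have "((\<lambda>q. tang f i q \<bullet> cJ (tang f k q)) has_derivative
      (\<lambda>h. tang f i q \<bullet> cJ (fst h *\<^sub>R sec f k 0 q + snd h *\<^sub>R sec f k 1 q)
        + (fst h *\<^sub>R sec f i 0 q + snd h *\<^sub>R sec f i 1 q) \<bullet> cJ (tang f k q))) (at q)"
    by (intro has_derivative_inner has_derivative_tang assms bounded_linear.has_derivative[OF cJ_linear])
  moreover have "((\<lambda>q. tang f i q \<bullet> cJ (tang f k q)) has_derivative (\<lambda>h. 0)) (at q)"
    by (rule has_derivative_transform_within_open[OF has_derivative_const[of 0] open_U assms(1)])
       (simp add: tang_normal)
  ultimately have "(\<lambda>h. tang f i q \<bullet> cJ (fst h *\<^sub>R sec f k 0 q + snd h *\<^sub>R sec f k 1 q)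
        + (fst h *\<^sub>R sec f i 0 q + snd h *\<^sub>R sec f i 1 q) \<bullet> cJ (tang f k q)) = (\<lambda>h. 0)"
    by (rule has_derivative_unique)
  from fun_cong[OF this, of "if j = 0 then (1, 0) else (0, 1)"]
  have "tang f i q \<bullet> cJ (sec f k j q) + sec f i j q \<bullet> cJ (tang f k q) = 0"
    using assms(2) by auto
  then show ?thesis using inner_cJ_left[of "tang f i q" "sec f k j q"] by (simp add: inner_commute)
qed

lemma cubic_sym12: "q \<in> U \<Longrightarrow> cubic f q u v w = cubic f q v u w"
  using sec_sym[of q] by (simp add: cubic_def d2f_def algebra_simps)

text \<open>Together with \<open>cubic_sym12\<close>, which comes from equality of mixed partials,
  this yields total symmetry.\<close>

lemma cubic_sym13: "q \<in> U \<Longrightarrow> cubic f q u v w = cubic f q w v u"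
  using sec_cJ_sym[of q 0 0 1] sec_cJ_sym[of q 1 0 1]
  by (simp add: cubic_def d2f_def df_def cJ_add cJ_scale inner_add_left inner_add_right algebra_simps)

lemma has_derivative_half_norm:
  "q \<in> U \<Longrightarrow> ((\<lambda>q. (f q \<bullet> f q) / 2) has_derivative
      (\<lambda>h. fst h *\<^sub>R (f q \<bullet> tang f 0 q) + snd h *\<^sub>R (f q \<bullet> tang f 1 q))) (at q)"
  by (rule has_derivative_eq_rhs, rule bounded_linear.has_derivative[OF bounded_linear_divide
        has_derivative_inner[OF has_derivative_f has_derivative_f]])
     (auto simp: fun_eq_iff df_def inner_add_left inner_add_right inner_commute)

lemma has_derivative_grad_half_norm:
  "q \<in> U \<Longrightarrow> ((\<lambda>q. f q \<bullet> tang f i q) has_derivative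
      (\<lambda>h. fst h *\<^sub>R (tang f 0 q \<bullet> tang f i q + f q \<bullet> sec f i 0 q)
        + snd h *\<^sub>R (tang f 1 q \<bullet> tang f i q + f q \<bullet> sec f i 1 q))) (at q)"
  by (rule has_derivative_eq_rhs, rule has_derivative_inner[OF has_derivative_f has_derivative_tang])
     (auto simp: fun_eq_iff df_def inner_add_left inner_add_right algebra_simps)

end

section \<open>Orthonormal tangent frames at a single point\<close>

locale tangent_frame = lagrangian_chart +
  fixes p c d e1 e2
  assumes p: "p \<in> U"
    and e1: "e1 = df f p c" and e2: "e2 = df f p d"
    and unit: "norm e1 = 1" "norm e2 = 1" and orth: "e1 \<bullet> e2 = 0"
begin

lemma unit_inner: "e1 \<bullet> e1 = 1" "e2 \<bullet> e2 = 1" "e2 \<bullet> e1 = 0"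
  using unit orth by (simp_all add: norm_eq_1 inner_commute)

lemma normal_zero: "e1 \<bullet> cJ e2 = 0" "e2 \<bullet> cJ e1 = 0"
  using df_normal[OF p] by (simp_all add: e1 e2)

lemma df_normal_zero: "df f p u \<bullet> cJ e1 = 0" "df f p u \<bullet> cJ e2 = 0"
  using df_normal[OF p] by (simp_all add: e1 e2)

lemma expand:
  "v = (v \<bullet> e1) *\<^sub>R e1 + (v \<bullet> e2) *\<^sub>R e2 + (v \<bullet> cJ e1) *\<^sub>R cJ e1 + (v \<bullet> cJ e2) *\<^sub>R cJ e2"
  by (intro lagrangian_frame_expand unit orth normal_zero)

lemma df_expand: "df f p u = (df f p u \<bullet> e1) *\<^sub>R e1 + (df f p u \<bullet> e2) *\<^sub>R e2"
  using expand[of "df f p u"] by (simp add: df_normal_zero)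

lemma tang_expand:
  assumes "i = 0 \<or> i = 1"
  shows "tang f i p = (tang f i p \<bullet> e1) *\<^sub>R e1 + (tang f i p \<bullet> e2) *\<^sub>R e2"
proof -
  have "tang f i p = df f p (if i = 0 then (1, 0) else (0, 1))"
    using assms by (auto simp: df_def)
  then show ?thesis using df_expand by metis
qed

text \<open>The coordinate vectors \<open>c\<close>, \<open>d\<close> of an orthonormal frame factor
  the inverse metric as \<open>c c^T + d d^T\<close>. This turns every contraction with
  \<open>ginv\<close> into evaluation on the frame.\<close>

lemma ginv_frame:
  "ginv f 0 0 p = fst c * fst c + fst d * fst d"
  "ginv f 0 1 p = fst c * snd c + fst d * snd d"
  "ginv f 1 0 p = snd c * fst c + snd d * fst d"
  "ginv f 1 1 p = snd c * snd c + snd d * snd d"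
proof -
  let ?g00 = "gm f 0 0 p" and ?g01 = "gm f 0 1 p" and ?g11 = "gm f 1 1 p"
  define a0 where "a0 = tang f 0 p \<bullet> e1" define a1 where "a1 = tang f 1 p \<bullet> e1"
  define b0 where "b0 = tang f 0 p \<bullet> e2" define b1 where "b1 = tang f 1 p \<bullet> e2"
  have t: "tang f 0 p = a0 *\<^sub>R e1 + b0 *\<^sub>R e2" "tang f 1 p = a1 *\<^sub>R e1 + b1 *\<^sub>R e2"
    using tang_expand unfolding a0_def a1_def b0_def b1_def by blast+
  have g: "?g00 = a0 * a0 + b0 * b0" "?g01 = a0 * a1 + b0 * b1" "?g11 = a1 * a1 + b1 * b1"
    "gm f 1 0 p = ?g01"
    unfolding gm_def t by (simp_all add: inner_add_left inner_add_right unit_inner orth)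
  have det: "detg f p = (a0 * b1 - a1 * b0)\<^sup>2"
    unfolding detg_def g by (simp add: power2_eq_square algebra_simps)
  have inner_df: "df f p u \<bullet> v = fst u * (tang f 0 p \<bullet> v) + snd u * (tang f 1 p \<bullet> v)" for u v
    by (simp add: df_def inner_add_left)
  have w: "fst c * a0 + snd c * a1 = 1" "fst c * b0 + snd c * b1 = 0"
      "fst d * a0 + snd d * a1 = 0" "fst d * b0 + snd d * b1 = 1"
    using unit_inner orth inner_df[of c] inner_df[of d]
    by (auto simp: a0_def a1_def b0_def b1_def simp flip: e1 e2)
  define D where "D = a0 * b1 - a1 * b0"
  have D: "D \<noteq> 0" using det detg_pos[OF p] by (auto simp: D_def)
  \<comment> \<open>Cramer's rule for the matrix of the coordinate tangent vectors in the
    frame.\<close>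
  have cd: "D * fst c = b1" "D * snd c = - b0" "D * fst d = - a1" "D * snd d = a0"
    using w unfolding D_def by algebra+
  have cd': "fst c = b1 / D" "snd c = - b0 / D" "fst d = - a1 / D" "snd d = a0 / D"
    using cd D by (simp_all add: field_simps)
  show "ginv f 0 0 p = fst c * fst c + fst d * fst d"
    "ginv f 0 1 p = fst c * snd c + fst d * snd d"
    "ginv f 1 0 p = snd c * fst c + snd d * fst d"
    "ginv f 1 1 p = snd c * snd c + snd d * snd d"
    unfolding ginv_def det D_def[symmetric] cd' using D
    by (simp_all add: g g[simplified] power2_eq_square add_divide_distrib[symmetric] algebra_simps)
qed

lemma nproj_frame: "nproj f p v = (v \<bullet> cJ e1) *\<^sub>R cJ e1 + (v \<bullet> cJ e2) *\<^sub>R cJ e2"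
proof -
  have "tproj f p v = (v \<bullet> e1) *\<^sub>R e1 + (v \<bullet> e2) *\<^sub>R e2"
    unfolding tproj_def e1 e2 df_def
    by (simp add: ginv_frame[simplified] inner_add_right scaleR_add_right scaleR_add_left algebra_simps)
  then show ?thesis using expand[of v] by (simp add: nproj_def algebra_simps)
qed

lemma meancurv_frame:
  "meancurv f p \<bullet> cJ e1 = cubic f p c c c + cubic f p d d c"
  "meancurv f p \<bullet> cJ e2 = cubic f p c c d + cubic f p d d d"
  unfolding meancurv_def sff_def nproj_frame
  by (simp_all add: ginv_frame[simplified] inner_add_left inner_add_right normal_zero unit_inner orth cubic_def d2f_def
      e1[symmetric] e2[symmetric] algebra_simps)

text \<open>Total symmetry leaves four independent components; the weights 1, 3, 3, 1 count the
  orderings of their indices.\<close>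

lemma sqA_frame:
  "sqA f p = (cubic f p c c c)\<^sup>2 + 3 * (cubic f p c c d)\<^sup>2 + 3 * (cubic f p d d c)\<^sup>2 + (cubic f p d d d)\<^sup>2"
proof -
  let ?s = "\<lambda>i j e. sec f i j p \<bullet> cJ e"
  have S: "sff f i j p \<bullet> sff f k l p = ?s i j e1 * ?s k l e1 + ?s i j e2 * ?s k l e2" for i j k l
    by (simp add: sff_def nproj_frame inner_add_left inner_add_right unit_inner orth)
  have C: "cubic f p u v c = fst u * fst v * ?s 0 0 e1 + fst u * snd v * ?s 0 1 e1
       + snd u * fst v * ?s 1 0 e1 + snd u * snd v * ?s 1 1 e1"
    "cubic f p u v d = fst u * fst v * ?s 0 0 e2 + fst u * snd v * ?s 0 1 e2
       + snd u * fst v * ?s 1 0 e2 + snd u * snd v * ?s 1 1 e2" for u v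
    by (simp_all add: cubic_def d2f_def inner_add_left flip: e1 e2)
  have "sqA f p = ((cubic f p c c c)\<^sup>2 + (cubic f p c d c)\<^sup>2 + (cubic f p d c c)\<^sup>2 + (cubic f p d d c)\<^sup>2)
      + ((cubic f p c c d)\<^sup>2 + (cubic f p c d d)\<^sup>2 + (cubic f p d c d)\<^sup>2 + (cubic f p d d d)\<^sup>2)"
    unfolding sqA_def S C by (simp add: ginv_frame[simplified] power2_eq_square algebra_simps)
  then show ?thesis
    using cubic_sym12[OF p, of c d] cubic_sym13[OF p, of c d c] cubic_sym13[OF p, of c c d]
      cubic_sym13[OF p, of c d d] cubic_sym12[OF p, of c d c] by simp
qed

lemma cubic_df:
  "cubic f p u v w = (df f p w \<bullet> e1) * cubic f p u v c + (df f p w \<bullet> e2) * cubic f p u v d"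
proof -
  have "cubic f p u v w = d2f f p u v \<bullet> cJ ((df f p w \<bullet> e1) *\<^sub>R e1 + (df f p w \<bullet> e2) *\<^sub>R e2)"
    unfolding cubic_def using df_expand[of w] by simp
  then show ?thesis by (simp add: cubic_def cJ_add cJ_scale inner_add_right e1 e2)
qed

end

section \<open>The squared norm of a self-shrinker\<close>

text \<open>For a unit tangent vector \<open>e\<close>, these are the coordinates of its quarter
  turn in the induced metric. The explicit formula makes the resulting frame field visibly
  differentiable in \<open>q\<close>.\<close>

definition perp :: "param \<Rightarrow> real \<times> real \<Rightarrow> complex \<times> complex \<Rightarrow> real \<times> real" where
  "perp f q e = (- (e \<bullet> tang f 1 q) / sqrt (detg f q), (e \<bullet> tang f 0 q) / sqrt (detg f q))"

context lagrangian_chart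
begin

lemma gm_sym: "gm f 1 0 q = gm f 0 1 q"
  by (simp add: gm_def inner_commute)

lemma gm_pos:
  assumes "q \<in> U" shows "0 < gm f 0 0 q" "0 < gm f 1 1 q"
proof -
  have "0 < gm f 0 0 q * gm f 1 1 q"
    using detg_pos[OF assms] unfolding detg_def gm_sym by (smt (verit) zero_le_square)
  moreover have "0 \<le> gm f 0 0 q" "0 \<le> gm f 1 1 q" by (simp_all add: gm_def)
  ultimately show "0 < gm f 0 0 q" "0 < gm f 1 1 q"
    by (simp_all add: zero_less_mult_iff)
qed

lemma ginv_pos:
  assumes "q \<in> U"
  shows "0 < ginv f 0 0 q" "0 < ginv f 0 0 q * ginv f 1 1 q - ginv f 0 1 q * ginv f 0 1 q"
proof -
  have D: "0 < detg f q" by (rule detg_pos[OF assms])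
  then show "0 < ginv f 0 0 q" using gm_pos[OF assms] by (simp add: ginv_def)
  have "ginv f 0 0 q * ginv f 1 1 q - ginv f 0 1 q * ginv f 0 1 q = detg f q / (detg f q * detg f q)"
    unfolding ginv_def by (simp add: gm_sym[simplified] detg_def[of f q] diff_divide_distrib algebra_simps)
  then show "0 < ginv f 0 0 q * ginv f 1 1 q - ginv f 0 1 q * ginv f 0 1 q" using D by simp
qed

text \<open>A normal position vector is \<open>J\<close> of a tangent vector by the Lagrangian
  condition, so \<open>J x\<close> is tangent and, normalized, can serve as first frame
  vector.\<close>

lemma tangent_frame_normal_position:
  assumes q: "q \<in> U" and n: "f q \<bullet> tang f 0 q = 0" "f q \<bullet> tang f 1 q = 0" and nz: "f q \<noteq> 0"
  defines "e \<equiv> (1 / norm (f q)) *\<^sub>R cJ (f q)"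
  shows "\<exists>c. tangent_frame f U q c (perp f q e) e (df f q (perp f q e))"
proof -
  have "f q \<in> cJ ` span {tang f 0 q, tang f 1 q}"
    using lagrangian[OF q] n by (simp add: lagrangian_at_def)
  then obtain t where t: "t \<in> span {tang f 0 q, tang f 1 q}" "f q = cJ t" by blast
  obtain k0 where "t - k0 *\<^sub>R tang f 0 q \<in> span {tang f 1 q}"
    using span_breakdown_eq[of t "tang f 0 q" "{tang f 1 q}"] t(1) by blast
  then obtain k1 where "t - k0 *\<^sub>R tang f 0 q = k1 *\<^sub>R tang f 1 q"
    by (auto simp: span_singleton)
  then have tk: "t = k0 *\<^sub>R tang f 0 q + k1 *\<^sub>R tang f 1 q" by (simp add: algebra_simps)
  \<comment> \<open>The signs come from \<open>J (J t) = - t\<close>.\<close>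
  define c where "c = (- k0 / norm (f q), - k1 / norm (f q))"
  let ?D = "detg f q"
  have D: "0 < ?D" by (rule detg_pos[OF q])
  have "e = - (1 / norm (f q)) *\<^sub>R t"
    unfolding e_def t(2) by simp
  then have ec: "e = df f q c"
    unfolding tk by (simp add: df_def c_def algebra_simps)
  have ne: "norm e = 1" using nz by (simp add: e_def)
  let ?g00 = "gm f 0 0 q" and ?g01 = "gm f 0 1 q" and ?g11 = "gm f 1 1 q"
  define a0 where "a0 = e \<bullet> tang f 0 q"
  define a1 where "a1 = e \<bullet> tang f 1 q"
  have a: "a0 = fst c * ?g00 + snd c * ?g01" "a1 = fst c * ?g01 + snd c * ?g11"
    unfolding a0_def a1_def ec df_def gm_def
    by (simp_all add: inner_add_left inner_add_right inner_commute)
  have c1: "fst c * a0 + snd c * a1 = 1"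
  proof -
    have "e \<bullet> df f q c = fst c * a0 + snd c * a1"
      by (simp add: df_def inner_add_right a0_def a1_def)
    moreover have "e \<bullet> e = 1" using ne by (simp add: norm_eq_1)
    ultimately show ?thesis by (simp flip: ec)
  qed
  have detg: "?D = ?g00 * ?g11 - ?g01 * ?g01" by (simp only: detg_def gm_sym)
  have pe: "perp f q e = (- a1 / sqrt ?D, a0 / sqrt ?D)"
    by (simp add: perp_def a0_def a1_def)
  have "df f q (perp f q e) \<bullet> df f q (perp f q e)
      = (a1 * a1 * ?g00 - 2 * a0 * a1 * ?g01 + a0 * a0 * ?g11) / (sqrt ?D * sqrt ?D)"
    by (simp add: pe df_def gm_def inner_diff_left inner_diff_right inner_commute diff_divide_distrib
        add_divide_distrib algebra_simps del: real_sqrt_mult_self)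
  also have "\<dots> = (a1 * a1 * ?g00 - 2 * a0 * a1 * ?g01 + a0 * a0 * ?g11) / ?D"
    using D by simp
  \<comment> \<open>The last factor is \<open>e . e = 1\<close>: the quarter turn preserves
    length.\<close>
  also have "a1 * a1 * ?g00 - 2 * a0 * a1 * ?g01 + a0 * a0 * ?g11 = ?D * (fst c * a0 + snd c * a1)"
    unfolding a detg by (simp add: algebra_simps)
  finally have n2: "norm (df f q (perp f q e)) = 1" using D c1 by (simp add: norm_eq_1)
  have "e \<bullet> df f q (perp f q e) = 0"
    by (simp add: df_def pe inner_diff_right a0_def a1_def)
  then show ?thesis
    using q ec ne n2
    by (intro exI[of _ c] tangent_frame.intro tangent_frame_axioms.intro lagrangian_chart_axioms) auto
qed

end

locale shrinker_chart = lagrangian_chart +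
  assumes shrinker: "\<And>q. q \<in> U \<Longrightarrow> self_shrinker_at f q"
begin

text \<open>The Laplacian of the squared norm is \<open>2 (2 - |H|^2)\<close>; here it is written with coordinate
  derivatives, the coefficients \<open>B\<close> being contracted Christoffel symbols.\<close>

lemma laplacian_half_norm:
  fixes q
  defines "M \<equiv> ginv f 0 0 q *\<^sub>R sec f 0 0 q + ginv f 0 1 q *\<^sub>R sec f 0 1 q
      + ginv f 0 1 q *\<^sub>R sec f 1 0 q + ginv f 1 1 q *\<^sub>R sec f 1 1 q"
  defines "B0 \<equiv> ginv f 0 0 q * (M \<bullet> tang f 0 q) + ginv f 0 1 q * (M \<bullet> tang f 1 q)"
  defines "B1 \<equiv> ginv f 0 1 q * (M \<bullet> tang f 0 q) + ginv f 1 1 q * (M \<bullet> tang f 1 q)"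
  assumes q: "q \<in> U" and le: "f q \<bullet> f q \<le> 2"
  shows "0 \<le> ginv f 0 0 q * (tang f 0 q \<bullet> tang f 0 q + f q \<bullet> sec f 0 0 q)
      + ginv f 0 1 q * (tang f 1 q \<bullet> tang f 0 q + f q \<bullet> sec f 0 1 q)
      + ginv f 0 1 q * (tang f 0 q \<bullet> tang f 1 q + f q \<bullet> sec f 1 0 q)
      + ginv f 1 1 q * (tang f 1 q \<bullet> tang f 1 q + f q \<bullet> sec f 1 1 q)
      - B0 * (f q \<bullet> tang f 0 q) - B1 * (f q \<bullet> tang f 1 q)"
proof -
  let ?D = "detg f q"
  have D: "0 < ?D" by (rule detg_pos[OF q])
  have i10: "ginv f 1 0 q = ginv f 0 1 q" by (simp add: ginv_def gm_def inner_commute)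
  have i: "ginv f 0 0 q = gm f 1 1 q / ?D" "ginv f 0 1 q = - gm f 0 1 q / ?D"
    "ginv f 1 1 q = gm f 0 0 q / ?D" by (simp_all add: ginv_def)
  \<comment> \<open>The trace of the inverse metric against the metric is the dimension of the
    surface.\<close>
  have tr: "ginv f 0 0 q * gm f 0 0 q + 2 * ginv f 0 1 q * gm f 0 1 q + ginv f 1 1 q * gm f 1 1 q = 2"
  proof -
    have "ginv f 0 0 q * gm f 0 0 q + 2 * ginv f 0 1 q * gm f 0 1 q + ginv f 1 1 q * gm f 1 1 q
      = 2 * ((gm f 0 0 q * gm f 1 1 q - gm f 0 1 q * gm f 0 1 q) / ?D)"
      unfolding i by (simp add: diff_divide_distrib algebra_simps)
    also have "gm f 0 0 q * gm f 1 1 q - gm f 0 1 q * gm f 0 1 q = ?D"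
      by (simp only: detg_def gm_sym)
    finally show ?thesis using D by simp
  qed
  have tproj: "tproj f q w = (ginv f 0 0 q * (w \<bullet> tang f 0 q) + ginv f 0 1 q * (w \<bullet> tang f 1 q)) *\<^sub>R tang f 0 q
      + (ginv f 0 1 q * (w \<bullet> tang f 0 q) + ginv f 1 1 q * (w \<bullet> tang f 1 q)) *\<^sub>R tang f 1 q" for w
    by (simp add: tproj_def i10[simplified] algebra_simps)
  have H: "meancurv f q = nproj f q M"
    unfolding meancurv_def sff_def nproj_def tproj M_def
    by (simp add: i10[simplified] inner_add_left algebra_simps)
  have "f q \<bullet> M = f q \<bullet> tproj f q M + f q \<bullet> meancurv f q"
    unfolding H nproj_def by (simp add: inner_diff_right)
  also have "\<dots> = B0 * (f q \<bullet> tang f 0 q) + B1 * (f q \<bullet> tang f 1 q) - f q \<bullet> nproj f q (f q)"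
    using shrinker[OF q] unfolding self_shrinker_at_def tproj B0_def B1_def
    by (simp add: inner_add_right)
  finally have fM: "f q \<bullet> M = B0 * (f q \<bullet> tang f 0 q) + B1 * (f q \<bullet> tang f 1 q) - f q \<bullet> nproj f q (f q)" .
  \<comment> \<open>The left-out quantity is the squared length of the tangential part of
    \<open>x\<close>, so the normal part has squared length at most \<open>|x|^2\<close>, hence at
    most 2.\<close>
  have "0 \<le> f q \<bullet> tproj f q (f q)"
  proof -
    let ?u = "f q \<bullet> tang f 0 q" and ?v = "f q \<bullet> tang f 1 q"
    have e: "f q \<bullet> tproj f q (f q) = ginv f 0 0 q * ?u * ?u + 2 * ginv f 0 1 q * ?u * ?v + ginv f 1 1 q * ?v * ?v"
      by (simp add: tproj inner_add_right algebra_simps)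
    show ?thesis
      using ginv_pos[OF q] quadratic_form_pos[of "ginv f 0 0 q" "ginv f 1 1 q" "ginv f 0 1 q" ?u ?v] unfolding e
      by (cases "?u \<noteq> 0 \<or> ?v \<noteq> 0") auto
  qed
  then have "f q \<bullet> nproj f q (f q) \<le> 2" using le by (simp add: nproj_def inner_diff_right)
  moreover have "ginv f 0 0 q * (tang f 0 q \<bullet> tang f 0 q + f q \<bullet> sec f 0 0 q)
      + ginv f 0 1 q * (tang f 1 q \<bullet> tang f 0 q + f q \<bullet> sec f 0 1 q)
      + ginv f 0 1 q * (tang f 0 q \<bullet> tang f 1 q + f q \<bullet> sec f 1 0 q)
      + ginv f 1 1 q * (tang f 1 q \<bullet> tang f 1 q + f q \<bullet> sec f 1 1 q) = 2 + f q \<bullet> M"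
    using tr unfolding gm_def M_def inner_add_right by (simp add: inner_commute algebra_simps)
  ultimately show ?thesis using fM by linarith
qed

text \<open>The strong minimum principle is applied to \<open>1 - |x|^2 / 2\<close>; halving removes
  the factor 2 from the gradient. The drift \<open>B0\<close>, \<open>B1\<close> converts the
  coordinate Hessian into the intrinsic Laplacian.\<close>

lemma norm_max_spreads:
  assumes le: "\<And>q. q \<in> U \<Longrightarrow> f q \<bullet> f q \<le> 2" and p: "p \<in> U" "f p \<bullet> f p = 2"
  shows "\<exists>r>0. ball p r \<subseteq> U \<and> (\<forall>q\<in>ball p r. f q \<bullet> f q = 2)"
proof -
  define M where "M q = ginv f 0 0 q *\<^sub>R sec f 0 0 q + ginv f 0 1 q *\<^sub>R sec f 0 1 q
      + ginv f 0 1 q *\<^sub>R sec f 1 0 q + ginv f 1 1 q *\<^sub>R sec f 1 1 q" for q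
  define B0 where "B0 q = ginv f 0 0 q * (M q \<bullet> tang f 0 q) + ginv f 0 1 q * (M q \<bullet> tang f 1 q)" for q
  define B1 where "B1 q = ginv f 0 1 q * (M q \<bullet> tang f 0 q) + ginv f 1 1 q * (M q \<bullet> tang f 1 q)" for q
  have cg: "continuous_on U (gm f i j)" for i j
    unfolding gm_def[abs_def] by (intro continuous_intros continuous_tang)
  have cD: "continuous_on U (detg f)"
    unfolding detg_def[abs_def] by (intro continuous_intros cg)
  have ci: "continuous_on U (ginv f 0 0)" "continuous_on U (ginv f 0 1)" "continuous_on U (ginv f 1 1)"
    unfolding ginv_def[abs_def] using detg_pos
    by (auto intro!: continuous_intros cg cD simp del: One_nat_def) fastforce+
  have cM: "continuous_on U M" unfolding M_def[abs_def] by (intro continuous_intros ci continuous_sec)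
  have cB: "continuous_on U B0" "continuous_on U B1"
    unfolding B0_def[abs_def] B1_def[abs_def] by (intro continuous_intros ci cM continuous_tang)+
  interpret supersolution U "\<lambda>q. 1 - (f q \<bullet> f q) / 2"
    "\<lambda>q. - (f q \<bullet> tang f 0 q)" "\<lambda>q. - (f q \<bullet> tang f 1 q)"
    "\<lambda>q. - (tang f 0 q \<bullet> tang f 0 q + f q \<bullet> sec f 0 0 q)" "\<lambda>q. - (tang f 1 q \<bullet> tang f 0 q + f q \<bullet> sec f 0 1 q)"
    "\<lambda>q. - (tang f 0 q \<bullet> tang f 1 q + f q \<bullet> sec f 1 0 q)" "\<lambda>q. - (tang f 1 q \<bullet> tang f 1 q + f q \<bullet> sec f 1 1 q)"
    "ginv f 0 0" "ginv f 0 1" "ginv f 1 1" "\<lambda>q. - B0 q" "\<lambda>q. - B1 q"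
  proof
    fix q assume q: "q \<in> U"
    show "((\<lambda>q. 1 - (f q \<bullet> f q) / 2) has_derivative
       (\<lambda>h. fst h *\<^sub>R - (f q \<bullet> tang f 0 q) + snd h *\<^sub>R - (f q \<bullet> tang f 1 q))) (at q)"
      by (rule has_derivative_eq_rhs[OF has_derivative_diff[OF has_derivative_const has_derivative_half_norm[OF q]]])
         (simp add: fun_eq_iff algebra_simps)
    show "((\<lambda>q. - (f q \<bullet> tang f 0 q)) has_derivative
       (\<lambda>h. fst h *\<^sub>R - (tang f 0 q \<bullet> tang f 0 q + f q \<bullet> sec f 0 0 q)
         + snd h *\<^sub>R - (tang f 1 q \<bullet> tang f 0 q + f q \<bullet> sec f 0 1 q))) (at q)"
      by (rule has_derivative_eq_rhs[OF has_derivative_minus[OF has_derivative_grad_half_norm[OF q]]])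
         (simp add: fun_eq_iff algebra_simps)
    show "((\<lambda>q. - (f q \<bullet> tang f 1 q)) has_derivative
       (\<lambda>h. fst h *\<^sub>R - (tang f 0 q \<bullet> tang f 1 q + f q \<bullet> sec f 1 0 q)
         + snd h *\<^sub>R - (tang f 1 q \<bullet> tang f 1 q + f q \<bullet> sec f 1 1 q))) (at q)"
      by (rule has_derivative_eq_rhs[OF has_derivative_minus[OF has_derivative_grad_half_norm[OF q]]])
         (simp add: fun_eq_iff algebra_simps)
    show "0 \<le> 1 - (f q \<bullet> f q) / 2" using le[OF q] by simp
    show "0 < ginv f 0 0 q" "0 < ginv f 0 0 q * ginv f 1 1 q - ginv f 0 1 q * ginv f 0 1 q"
      by (rule ginv_pos[OF q])+
    show "ginv f 0 0 q * - (tang f 0 q \<bullet> tang f 0 q + f q \<bullet> sec f 0 0 q)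
      + ginv f 0 1 q * - (tang f 1 q \<bullet> tang f 0 q + f q \<bullet> sec f 0 1 q)
      + ginv f 0 1 q * - (tang f 0 q \<bullet> tang f 1 q + f q \<bullet> sec f 1 0 q)
      + ginv f 1 1 q * - (tang f 1 q \<bullet> tang f 1 q + f q \<bullet> sec f 1 1 q)
      + - B0 q * - (f q \<bullet> tang f 0 q) + - B1 q * - (f q \<bullet> tang f 1 q) \<le> 0"
      using laplacian_half_norm[OF q le[OF q]] unfolding B0_def B1_def M_def by linarith
  qed (use open_U ci cB in \<open>auto intro!: continuous_intros\<close>)
  show ?thesis using strong_minimum_principle[of p] p by auto
qed

lemma norm_at_max:
  assumes p: "p \<in> U" and sq: "sqA f p \<le> 2"
    and r: "0 < r" "ball p r \<subseteq> U" and max: "\<And>q. q \<in> ball p r \<Longrightarrow> f q \<bullet> f q \<le> f p \<bullet> f p"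
  shows "f p \<bullet> f p = 2"
proof -
  have F: "((\<lambda>q. - ((f q \<bullet> f q) / 2)) has_derivative
       (\<lambda>h. fst h *\<^sub>R - (f q \<bullet> tang f 0 q) + snd h *\<^sub>R - (f q \<bullet> tang f 1 q))) (at q)" if "q \<in> U" for q
    by (rule has_derivative_eq_rhs[OF has_derivative_minus[OF has_derivative_half_norm[OF that]]])
       (simp add: fun_eq_iff algebra_simps)
  have F0: "((\<lambda>q. - (f q \<bullet> tang f 0 q)) has_derivative
       (\<lambda>h. fst h *\<^sub>R - (tang f 0 p \<bullet> tang f 0 p + f p \<bullet> sec f 0 0 p)
         + snd h *\<^sub>R - (tang f 1 p \<bullet> tang f 0 p + f p \<bullet> sec f 0 1 p))) (at p)"
    by (rule has_derivative_eq_rhs[OF has_derivative_minus[OF has_derivative_grad_half_norm[OF p]]])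
       (simp add: fun_eq_iff algebra_simps)
  have F1: "((\<lambda>q. - (f q \<bullet> tang f 1 q)) has_derivative
       (\<lambda>h. fst h *\<^sub>R - (tang f 0 p \<bullet> tang f 1 p + f p \<bullet> sec f 1 0 p)
         + snd h *\<^sub>R - (tang f 1 p \<bullet> tang f 1 p + f p \<bullet> sec f 1 1 p))) (at p)"
    by (rule has_derivative_eq_rhs[OF has_derivative_minus[OF has_derivative_grad_half_norm[OF p]]])
       (simp add: fun_eq_iff algebra_simps)
  have min: "- ((f p \<bullet> f p) / 2) \<le> - ((f q \<bullet> f q) / 2)" if "q \<in> ball p r" for q
    using max[OF that] by simp
  note mm = gradient_and_hessian_at_min[where F = "\<lambda>q. - ((f q \<bullet> f q) / 2)",
      OF r(1) F[OF subsetD[OF r(2)]] F0 F1 min]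
  have n: "f p \<bullet> tang f 0 p = 0" "f p \<bullet> tang f 1 p = 0" using mm(1,2) by auto
  have hess: "df f p u \<bullet> df f p u + f p \<bullet> d2f f p u u \<le> 0" for u
    using mm(3)[of "fst u" "snd u"]
    by (simp add: df_def d2f_def inner_add_left inner_add_right algebra_simps inner_commute)
  \<comment> \<open>At the origin the Hessian of \<open>|x|^2 / 2\<close> would be the metric
    itself, which is positive definite.\<close>
  have nz: "f p \<noteq> 0"
  proof
    assume "f p = 0"
    moreover have "df f p (1, 0) \<bullet> df f p (1, 0) = gm f 0 0 p" by (simp add: df_def gm_def)
    ultimately show False using hess[of "(1, 0)"] gm_pos(1)[OF p] by simp
  qed
  define \<rho> where "\<rho> = norm (f p)"
  have \<rho>: "\<rho> > 0" "f p \<bullet> f p = \<rho>\<^sup>2" using nz by (simp_all add: \<rho>_def power2_norm_eq_inner)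
  define e where "e = (1 / \<rho>) *\<^sub>R cJ (f p)"
  define d where "d = perp f p e"
  obtain c where "tangent_frame f U p c d e (df f p d)"
    using tangent_frame_normal_position[OF p n nz] unfolding e_def d_def \<rho>_def by blast
  then interpret tangent_frame f U p c d e "df f p d" .
  have Je: "cJ e = - (1 / \<rho>) *\<^sub>R f p" by (simp add: e_def cJ_scale)
  have fJ: "f p = - \<rho> *\<^sub>R cJ e" using \<rho>(1) by (simp add: Je)
  have fe: "f p \<bullet> cJ e = - \<rho>" "f p \<bullet> cJ (df f p d) = 0"
    by (subst fJ, simp add: unit_inner orth)+
  have "meancurv f p = - nproj f p (f p)" using shrinker[OF p] by (simp add: self_shrinker_at_def)
  then have H: "meancurv f p \<bullet> cJ e = \<rho>" "meancurv f p \<bullet> cJ (df f p d) = 0"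
    by (simp_all add: nproj_frame fe inner_add_left unit_inner orth)
  define a b k where "a = cubic f p c c c" and "b = cubic f p c c d" and "k = cubic f p d d c"
  have tr: "a + k = \<rho>" "cubic f p d d d = - b"
    using H meancurv_frame by (simp_all add: a_def b_def k_def)
  have A: "a\<^sup>2 + 3 * b\<^sup>2 + 3 * k\<^sup>2 + b\<^sup>2 \<le> 2"
    using sq sqA_frame tr(2) by (simp add: a_def b_def k_def)
  have "f p \<bullet> d2f f p d d = - \<rho> * k"
    by (subst fJ) (simp add: k_def cubic_def e1[symmetric] inner_commute)
  \<comment> \<open>The Hessian inequality in direction \<open>d\<close> reads
    \<open>1 - \<rho> * k <= 0\<close>, and the shrinker equation along \<open>J e\<close> gives
    \<open>\<rho> = a + k\<close>.\<close>
  then have "1 \<le> (a + k) * k" using hess[of d] unit_inner(2) tr(1) by simp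
  \<comment> \<open>The left-hand side is \<open>(a^2 + 3 k^2 + 4 b^2) - 2 (a + k) k\<close>, where
    the first bracket is at most 2 and \<open>(a + k) k\<close> is at least 1.\<close>
  then have "(a - k)\<^sup>2 + 4 * b\<^sup>2 \<le> 0" using A by (simp add: power2_eq_square algebra_simps)
  then have "(a - k)\<^sup>2 = 0" "b\<^sup>2 = 0"
    using zero_le_power2[of "a - k"] zero_le_power2[of b] by linarith+
  then have "a = k" "b = 0" by simp_all
  with A \<open>1 \<le> (a + k) * k\<close> have "k\<^sup>2 = 1 / 2" by (simp add: power2_eq_square)
  moreover have "\<rho> = 2 * k" using tr(1) \<open>a = k\<close> by simp
  ultimately show ?thesis by (simp add: \<rho>(2) power_mult_distrib)
qed

end

section \<open>Spherical self-shrinkers\<close>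

definition herm :: "complex \<times> complex \<Rightarrow> complex \<times> complex \<Rightarrow> complex" where
  "herm z w = fst z * cnj (fst w) + snd z * cnj (snd w)"

lemma bounded_linear_herm: "bounded_linear (\<lambda>z. herm z w)"
  unfolding herm_def
  by (intro bounded_linear_add bounded_linear_compose[OF bounded_linear_mult_left]
      bounded_linear_fst bounded_linear_snd)

lemmas herm_add = linear_add[OF bounded_linear.linear[OF bounded_linear_herm]]
  and herm_diff = linear_diff[OF bounded_linear.linear[OF bounded_linear_herm]]
  and herm_scale = linear_cmul[OF bounded_linear.linear[OF bounded_linear_herm]]

lemma herm_cJ: "herm (cJ z) w = \<i> * herm z w"
  by (simp add: herm_def cJ_def algebra_simps)

lemma herm_inner: "herm z w = Complex (z \<bullet> w) (z \<bullet> cJ w)"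
  by (simp add: herm_def cJ_def complex_eq_iff inner_prod_def inner_complex_def)

locale sphere_chart = shrinker_chart +
  assumes sphere: "\<And>q. q \<in> U \<Longrightarrow> f q \<bullet> f q = 2"
begin

lemma position_normal: "q \<in> U \<Longrightarrow> f q \<bullet> df f q u = 0"
proof -
  assume q: "q \<in> U"
  have "((\<lambda>q. f q \<bullet> f q) has_derivative (\<lambda>h. f q \<bullet> df f q h + df f q h \<bullet> f q)) (at q)"
    by (intro has_derivative_inner has_derivative_f q)
  moreover have "((\<lambda>q. f q \<bullet> f q) has_derivative (\<lambda>h. 0)) (at q)"
    by (rule has_derivative_transform_within_open[OF has_derivative_const[of 2] open_U q]) (simp add: sphere)
  ultimately have "(\<lambda>h. f q \<bullet> df f q h + df f q h \<bullet> f q) = (\<lambda>h. 0)" by (rule has_derivative_unique)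
  from fun_cong[OF this, of u] show ?thesis by (simp add: inner_commute)
qed

lemma tang_position: "q \<in> U \<Longrightarrow> f q \<bullet> tang f 0 q = 0" "q \<in> U \<Longrightarrow> f q \<bullet> tang f 1 q = 0"
  using position_normal[of q "(1, 0)"] position_normal[of q "(0, 1)"] by (simp_all add: df_def)

text \<open>Differentiating the orthogonality of \<open>x\<close> to the coordinate tangent vectors
  once more determines the second fundamental form in the direction of \<open>x\<close>.\<close>

lemma position_d2f:
  assumes q: "q \<in> U" shows "f q \<bullet> d2f f q u v = - (df f q u \<bullet> df f q v)"
proof -
  have s: "tang f j q \<bullet> tang f i q + f q \<bullet> sec f i j q = 0"
    if ij: "i = 0 \<or> i = 1" "j = 0 \<or> j = 1" for i j
  proof -
    have "((\<lambda>q. f q \<bullet> tang f i q) has_derivative (\<lambda>h. 0)) (at q)"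
      by (rule has_derivative_transform_within_open[OF has_derivative_const[of 0] open_U q])
         (use tang_position ij in auto)
    with has_derivative_grad_half_norm[OF q, of i]
    have "(\<lambda>h. fst h *\<^sub>R (tang f 0 q \<bullet> tang f i q + f q \<bullet> sec f i 0 q)
        + snd h *\<^sub>R (tang f 1 q \<bullet> tang f i q + f q \<bullet> sec f i 1 q)) = (\<lambda>h. 0)"
      by (rule has_derivative_unique)
    from fun_cong[OF this, of "if j = 0 then (1, 0) else (0, 1)"] show ?thesis
      using ij(2) by (auto simp del: scaleR_zero_left)
  qed
  have "f q \<bullet> sec f i j q = - (tang f i q \<bullet> tang f j q)" if "i = 0 \<or> i = 1" "j = 0 \<or> j = 1" for i j
    using s[OF that] by (simp add: inner_commute)
  from this[of 0 0] this[of 0 1] this[of 1 0] this[of 1 1] show ?thesis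
    by (simp add: d2f_def df_def inner_add_right inner_add_left algebra_simps)
qed

section \<open>The moving frame on the sphere of radius sqrt 2\<close>

definition E1 :: "real \<times> real \<Rightarrow> complex \<times> complex" where
  "E1 q = (1 / sqrt 2) *\<^sub>R cJ (f q)"

definition E2 :: "real \<times> real \<Rightarrow> complex \<times> complex" where
  "E2 q = df f q (perp f q (E1 q))"

lemma norm_f: "q \<in> U \<Longrightarrow> norm (f q) = sqrt 2"
  using sphere by (simp add: norm_eq_sqrt_inner)

lemma frame:
  assumes q: "q \<in> U"
  shows "\<exists>c. tangent_frame f U q c (perp f q (E1 q)) (E1 q) (E2 q)"
proof -
  have "f q \<noteq> 0" using sphere[OF q] by auto
  from tangent_frame_normal_position[OF q tang_position[OF q] this] show ?thesis
    unfolding norm_f[OF q] E2_def E1_def .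
qed

lemma cJ_E1: "cJ (E1 q) = - (1 / sqrt 2) *\<^sub>R f q"
  by (simp add: E1_def cJ_scale)

lemma cJ_f: "cJ (f q) = sqrt 2 *\<^sub>R E1 q"
  by (simp add: E1_def)

text \<open>Because \<open>J E1\<close> is a multiple of the position, \<open>position_d2f\<close>
  gives every component with last index \<open>c\<close>, and symmetry gives \<open>ccd\<close>. The
  remaining \<open>ddd\<close> follows from the shrinker equation: \<open>H\<close> is parallel to
  \<open>x\<close>, so the trace along \<open>J E2\<close> vanishes.\<close>

lemma
  assumes fr: "tangent_frame f U q c d (E1 q) (E2 q)"
  shows cubic_ccc: "cubic f q c c c = 1 / sqrt 2" and cubic_ccd: "cubic f q c c d = 0"
    and cubic_ddc: "cubic f q d d c = 1 / sqrt 2" and cubic_ddd: "cubic f q d d d = 0"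
proof -
  interpret tangent_frame f U q c d "E1 q" "E2 q" by (rule fr)
  have c: "cubic f q u v c = (df f q u \<bullet> df f q v) / sqrt 2" for u v
    unfolding cubic_def e1[symmetric] cJ_E1
    using position_d2f[OF p, of u v] by (simp add: inner_commute)
  show "cubic f q c c c = 1 / sqrt 2" "cubic f q d d c = 1 / sqrt 2"
    by (simp_all add: c unit_inner flip: e1 e2)
  have "cubic f q c d c = 0" by (simp add: c orth flip: e1 e2)
  then show ccd: "cubic f q c c d = 0" using cubic_sym13[OF p, of c c d] cubic_sym12[OF p, of c d c] by simp
  have "meancurv f q = - nproj f q (f q)" using shrinker[OF p] by (simp add: self_shrinker_at_def)
  moreover have "f q = - sqrt 2 *\<^sub>R cJ (E1 q)" by (simp add: cJ_E1)
  then have "f q \<bullet> cJ (E2 q) = 0" by (metis inner_cJ_cJ inner_scaleR_left orth mult_zero_right)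
  ultimately have "meancurv f q \<bullet> cJ (E2 q) = 0"
    by (simp add: nproj_frame inner_add_left orth)
  with meancurv_frame(2) ccd show "cubic f q d d d = 0" by simp
qed

lemma sqA_eq_2: "q \<in> U \<Longrightarrow> sqA f q = 2"
proof -
  assume q: "q \<in> U"
  obtain c where fr: "tangent_frame f U q c (perp f q (E1 q)) (E1 q) (E2 q)" using frame[OF q] by blast
  show ?thesis
    unfolding tangent_frame.sqA_frame[OF fr] cubic_ccc[OF fr] cubic_ccd[OF fr] cubic_ddc[OF fr] cubic_ddd[OF fr]
    by (simp add: power_divide)
qed

lemma E_inner:
  assumes q: "q \<in> U"
  shows "E1 q \<bullet> E1 q = 1" "E2 q \<bullet> E2 q = 1" "E1 q \<bullet> E2 q = 0" "E2 q \<bullet> E1 q = 0" "E2 q \<bullet> cJ (E1 q) = 0"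
proof -
  obtain c where "tangent_frame f U q c (perp f q (E1 q)) (E1 q) (E2 q)" using frame[OF q] by blast
  then interpret tangent_frame f U q c "perp f q (E1 q)" "E1 q" "E2 q" .
  show "E1 q \<bullet> E1 q = 1" "E2 q \<bullet> E2 q = 1" "E1 q \<bullet> E2 q = 0" "E2 q \<bullet> E1 q = 0" "E2 q \<bullet> cJ (E1 q) = 0"
    using unit_inner orth normal_zero by simp_all
qed

lemma has_derivative_E1:
  "q \<in> U \<Longrightarrow> (E1 has_derivative (\<lambda>h. (1 / sqrt 2) *\<^sub>R cJ (df f q h))) (at q)"
  unfolding E1_def[abs_def]
  by (intro has_derivative_scaleR_right bounded_linear.has_derivative[OF cJ_linear] has_derivative_f)

text \<open>Differentiating the coefficients of \<open>E2\<close> contributes only tangent vectors,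
  which are orthogonal to \<open>J E2\<close>. This one component can thus be read off without
  computing the coefficient derivatives.\<close>

lemma has_derivative_E2_ex:
  assumes q: "q \<in> U"
  shows "\<exists>D. (E2 has_derivative D) (at q) \<and> (\<forall>h. D h \<bullet> cJ (E2 q) = cubic f q (perp f q (E1 q)) h (perp f q (E1 q)))"
proof -
  have D: "0 < detg f q" by (rule detg_pos[OF q])
  have dg: "\<exists>D. (gm f i j has_derivative D) (at q)" for i j
    unfolding gm_def[abs_def] by (rule exI, rule has_derivative_inner[OF has_derivative_tang[OF q] has_derivative_tang[OF q]])
  then obtain D00 D01 D10 D11 where g: "(gm f 0 0 has_derivative D00) (at q)" "(gm f 0 1 has_derivative D01) (at q)"
    "(gm f 1 0 has_derivative D10) (at q)" "(gm f 1 1 has_derivative D11) (at q)" by meson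
  have "\<exists>D. (detg f has_derivative D) (at q)"
    unfolding detg_def[abs_def] by (rule exI, rule has_derivative_diff[OF has_derivative_mult[OF g(1,4)] has_derivative_mult[OF g(2,3)]])
  then obtain D' where D': "(detg f has_derivative D') (at q)" by blast
  have k: "\<exists>D. ((\<lambda>q. (E1 q \<bullet> tang f i q) / sqrt (detg f q)) has_derivative D) (at q)" for i
    by (rule exI, rule has_derivative_divide[OF has_derivative_inner[OF has_derivative_E1[OF q] has_derivative_tang[OF q]]
        has_derivative_real_sqrt[OF D D']]) (use D in simp)
  then obtain K0 where K0: "((\<lambda>q. (E1 q \<bullet> tang f 0 q) / sqrt (detg f q)) has_derivative K0) (at q)" by blast
  obtain K1 where K1: "((\<lambda>q. (E1 q \<bullet> tang f 1 q) / sqrt (detg f q)) has_derivative K1) (at q)" using k by blast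
  let ?d = "perp f q (E1 q)"
  let ?D = "\<lambda>h. (fst ?d *\<^sub>R (fst h *\<^sub>R sec f 0 0 q + snd h *\<^sub>R sec f 0 1 q) + (- K1 h) *\<^sub>R tang f 0 q)
      + (snd ?d *\<^sub>R (fst h *\<^sub>R sec f 1 0 q + snd h *\<^sub>R sec f 1 1 q) + K0 h *\<^sub>R tang f 1 q)"
  have E2_eq: "E2 = (\<lambda>q. (- ((E1 q \<bullet> tang f 1 q) / sqrt (detg f q))) *\<^sub>R tang f 0 q
      + ((E1 q \<bullet> tang f 0 q) / sqrt (detg f q)) *\<^sub>R tang f 1 q)"
    by (simp add: E2_def[abs_def] df_def perp_def)
  have "(E2 has_derivative ?D) (at q)"
    unfolding E2_eq
    by (rule has_derivative_eq_rhs[OF has_derivative_add[OF has_derivative_scaleR[OF has_derivative_minus[OF K1] has_derivative_tang[OF q]]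
        has_derivative_scaleR[OF K0 has_derivative_tang[OF q]]]])
       (simp add: perp_def)
  moreover have "?D h \<bullet> cJ (E2 q) = cubic f q ?d h ?d" for h
    using tang_normal[OF q]
    by (simp add: cubic_def d2f_def E2_def df_def[of f q ?d] inner_add_left inner_add_right cJ_add cJ_scale
        algebra_simps)
  ultimately show ?thesis by blast
qed

text \<open>The components along \<open>E1\<close>, \<open>E2\<close> and \<open>J E1\<close> come
  from differentiating the constant products of \<open>E2\<close> with those vectors; the one along
  \<open>J E2\<close> is a value of the cubic form. There is no tangential component, so the frame
  is parallel.\<close>

lemma has_derivative_E2:
  assumes q: "q \<in> U"
  shows "(E2 has_derivative (\<lambda>h. (1 / sqrt 2) *\<^sub>R
    ((df f q h \<bullet> E2 q) *\<^sub>R cJ (E1 q) + (df f q h \<bullet> E1 q) *\<^sub>R cJ (E2 q)))) (at q)"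
proof -
  let ?d = "perp f q (E1 q)"
  obtain c where fr: "tangent_frame f U q c ?d (E1 q) (E2 q)" using frame[OF q] by blast
  then interpret tangent_frame f U q c ?d "E1 q" "E2 q" .
  obtain D where D: "(E2 has_derivative D) (at q)" "\<And>h. D h \<bullet> cJ (E2 q) = cubic f q ?d h ?d"
    using has_derivative_E2_ex[OF q] by blast
  have const: "(\<lambda>h. A q \<bullet> B' h + A' h \<bullet> B q) = (\<lambda>h. 0)"
    if "(A has_derivative A') (at q)" "(B has_derivative B') (at q)" "\<And>x. x \<in> U \<Longrightarrow> A x \<bullet> B x = k"
    for A B :: "real \<times> real \<Rightarrow> complex \<times> complex" and A' B' and k :: real
  proof -
    have "((\<lambda>x. A x \<bullet> B x) has_derivative (\<lambda>h. 0)) (at q)"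
      by (rule has_derivative_transform_within_open[OF has_derivative_const[of k] open_U q]) (simp add: that(3))
    with has_derivative_inner[OF that(1,2)] show ?thesis by (rule has_derivative_unique)
  qed
  note dE1 = has_derivative_E1[OF q]
  have d1: "D h \<bullet> E1 q = 0" for h
    using fun_cong[OF const[OF D(1) dE1, of 0], of h] E_inner df_normal[OF q] by (simp add: E2_def)
  have d2: "D h \<bullet> E2 q = 0" for h
    using fun_cong[OF const[OF D(1) D(1), of 1], of h] E_inner by (simp add: inner_commute)
  have d3: "D h \<bullet> cJ (E1 q) = (df f q h \<bullet> E2 q) / sqrt 2" for h
    using fun_cong[OF const[OF D(1) bounded_linear.has_derivative[OF cJ_linear dE1], of 0], of h] E_inner
    by (simp add: cJ_scale inner_commute)
  have d4: "D h \<bullet> cJ (E2 q) = (df f q h \<bullet> E1 q) / sqrt 2" for h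
    using D(2)[of h] cubic_sym13[OF q, of h ?d ?d] cubic_sym12[OF q, of h ?d ?d] cubic_df[of ?d ?d h]
      cubic_ddc[OF fr] cubic_ddd[OF fr] by simp
  have "D h = (1 / sqrt 2) *\<^sub>R ((df f q h \<bullet> E2 q) *\<^sub>R cJ (E1 q) + (df f q h \<bullet> E1 q) *\<^sub>R cJ (E2 q))" for h
    using expand[of "D h"] by (simp add: d1 d2 d3 d4 algebra_simps)
  then have "D = (\<lambda>h. (1 / sqrt 2) *\<^sub>R ((df f q h \<bullet> E2 q) *\<^sub>R cJ (E1 q) + (df f q h \<bullet> E1 q) *\<^sub>R cJ (E2 q)))"
    by blast
  with D(1) show ?thesis by simp
qed

text \<open>For the Clifford torus \<open>(z1, z2)\<close> this is \<open>(z1, 0)\<close> for one sign and \<open>(0, z2)\<close> for the other.\<close>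

definition circ :: "real \<Rightarrow> real \<times> real \<Rightarrow> complex \<times> complex" where
  "circ s q = (1 / 2) *\<^sub>R (f q - (s * sqrt 2) *\<^sub>R cJ (E2 q))"

lemma cJ_circ: "s * s = 1 \<Longrightarrow> cJ (circ s q) = (1 / sqrt 2) *\<^sub>R (E1 q + s *\<^sub>R E2 q)"
proof -
  have "sqrt 2 / 2 = 1 / sqrt 2" "s * sqrt 2 / 2 = s / sqrt 2" by (simp_all add: field_simps)
  then show ?thesis by (simp add: circ_def cJ_scale cJ_diff cJ_f algebra_simps)
qed

lemma has_derivative_circ:
  assumes q: "q \<in> U" and s: "s * s = 1"
  shows "(circ s has_derivative (\<lambda>h. ((df f q h \<bullet> E1 q + s * (df f q h \<bullet> E2 q)) / sqrt 2) *\<^sub>R cJ (circ s q))) (at q)"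
proof -
  obtain c where "tangent_frame f U q c (perp f q (E1 q)) (E1 q) (E2 q)" using frame[OF q] by blast
  then interpret tangent_frame f U q c "perp f q (E1 q)" "E1 q" "E2 q" .
  have "(circ s has_derivative (\<lambda>h. (1 / 2) *\<^sub>R (df f q h - (s * sqrt 2) *\<^sub>R cJ ((1 / sqrt 2) *\<^sub>R
    ((df f q h \<bullet> E2 q) *\<^sub>R cJ (E1 q) + (df f q h \<bullet> E1 q) *\<^sub>R cJ (E2 q)))))) (at q)"
    unfolding circ_def[abs_def]
    by (intro has_derivative_scaleR_right has_derivative_diff has_derivative_f[OF q]
        bounded_linear.has_derivative[OF cJ_linear] has_derivative_E2[OF q])
  moreover have "(1 / 2) *\<^sub>R (df f q h - (s * sqrt 2) *\<^sub>R cJ ((1 / sqrt 2) *\<^sub>R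
    ((df f q h \<bullet> E2 q) *\<^sub>R cJ (E1 q) + (df f q h \<bullet> E1 q) *\<^sub>R cJ (E2 q))))
    = ((df f q h \<bullet> E1 q + s * (df f q h \<bullet> E2 q)) / sqrt 2) *\<^sub>R cJ (circ s q)" for h
  proof -
    define t1 t2 where "t1 = df f q h \<bullet> E1 q" and "t2 = df f q h \<bullet> E2 q"
    have dfh: "df f q h = t1 *\<^sub>R E1 q + t2 *\<^sub>R E2 q" unfolding t1_def t2_def by (rule df_expand)
    have "(1 / 2) *\<^sub>R (df f q h - (s * sqrt 2) *\<^sub>R cJ ((1 / sqrt 2) *\<^sub>R (t2 *\<^sub>R cJ (E1 q) + t1 *\<^sub>R cJ (E2 q))))
      = ((t1 + s * t2) / 2) *\<^sub>R E1 q + ((t2 + s * t1) / 2) *\<^sub>R E2 q"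
      by (simp add: dfh cJ_scale cJ_add algebra_simps add_divide_distrib)
    \<comment> \<open>Here \<open>s * s = 1\<close> makes the two coefficients proportional, leaving
      a multiple of \<open>E1 + s E2\<close>, the direction of \<open>J (circ s)\<close>.\<close>
    also have "(t2 + s * t1) / 2 = (t1 + s * t2) / 2 * s" using s by (simp add: algebra_simps)
    also have "((t1 + s * t2) / 2) *\<^sub>R E1 q + ((t1 + s * t2) / 2 * s) *\<^sub>R E2 q
      = ((t1 + s * t2) / 2) *\<^sub>R (E1 q + s *\<^sub>R E2 q)" by (simp add: scaleR_add_right)
    also have "\<dots> = ((t1 + s * t2) / sqrt 2) *\<^sub>R cJ (circ s q)"
      by (simp add: cJ_circ[OF s])
    finally show ?thesis by (simp add: t1_def t2_def)
  qed
  ultimately show ?thesis by simp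
qed

text \<open>Since the derivative of \<open>circ s\<close> is a real multiple of \<open>i\<close> times \<open>circ s\<close>,
  its complex line does not move.\<close>

lemma herm_circ_const:
  assumes S: "convex S" "open S" "S \<subseteq> U" and s: "s * s = 1" and ab: "a \<in> S" "b \<in> S"
  shows "cmod (herm (circ s a) w) = cmod (herm (circ s b) w)"
proof -
  let ?g = "\<lambda>q. herm (circ s q) w"
  have "((\<lambda>q. ?g q \<bullet> ?g q) has_derivative (\<lambda>h. 0)) (at q within S)" if "q \<in> S" for q
  proof (rule has_derivative_at_withinI)
    have q: "q \<in> U" using that S(3) by blast
    show "((\<lambda>q. ?g q \<bullet> ?g q) has_derivative (\<lambda>h. 0)) (at q)"
      by (rule has_derivative_eq_rhs[OF has_derivative_inner])
         (rule bounded_linear.has_derivative[OF bounded_linear_herm has_derivative_circ[OF q s]],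
          rule bounded_linear.has_derivative[OF bounded_linear_herm has_derivative_circ[OF q s]],
          auto simp: herm_scale herm_cJ inner_complex_def fun_eq_iff)
  qed
  then obtain k where "\<And>q. q \<in> S \<Longrightarrow> ?g q \<bullet> ?g q = k"
    using has_derivative_zero_constant[OF S(1), of "\<lambda>q. ?g q \<bullet> ?g q"] by blast
  then show ?thesis using ab by (simp add: norm_eq_sqrt_inner)
qed

lemma circ_sum: "circ 1 q + circ (- 1) q = f q"
  by (simp add: circ_def algebra_simps flip: scaleR_add_left)

lemma position_cJ_E2: "q \<in> U \<Longrightarrow> f q \<bullet> cJ (E2 q) = 0" "q \<in> U \<Longrightarrow> cJ (E2 q) \<bullet> f q = 0"
  using inner_cJ_left[of "f q" "E2 q"] E_inner(3)[of q] by (simp_all add: cJ_f inner_commute)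

lemma circ_inner:
  assumes q: "q \<in> U"
  shows "circ s q \<bullet> circ t q = (1 + s * t) / 2"
  using sphere[OF q] position_cJ_E2[OF q] E_inner(2)[OF q]
  by (simp add: circ_def inner_diff_left inner_diff_right algebra_simps)

lemma norm_circ: "q \<in> U \<Longrightarrow> s * s = 1 \<Longrightarrow> norm (circ s q) = 1"
  by (simp add: norm_eq_1 circ_inner)

lemma herm_circ_circ:
  assumes q: "q \<in> U" and s: "s * s = 1"
  shows "herm (circ s q) (circ (- s) q) = 0"
proof -
  have "f q \<bullet> E1 q = 0" by (simp add: E1_def)
  moreover have "f q \<bullet> E2 q = 0" unfolding E2_def by (rule position_normal[OF q])
  moreover have "cJ (E2 q) \<bullet> E1 q = 0" using E_inner(5)[OF q] by (simp add: inner_cJ_left)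
  ultimately have "circ s q \<bullet> cJ (circ (- s) q) = 0"
    using s by (simp add: cJ_circ circ_def[of s] inner_diff_left inner_diff_right)
  then show ?thesis using s by (simp add: herm_inner circ_inner[OF q] complex_eq_iff)
qed

lemma cJ_circ_tangent:
  assumes q: "q \<in> U" and s: "s * s = 1"
  shows "\<exists>u. df f q u = cJ (circ s q)"
proof -
  obtain c where "tangent_frame f U q c (perp f q (E1 q)) (E1 q) (E2 q)" using frame[OF q] by blast
  then interpret tangent_frame f U q c "perp f q (E1 q)" "E1 q" "E2 q" .
  have "df f q ((1 / sqrt 2) *\<^sub>R c + (s / sqrt 2) *\<^sub>R perp f q (E1 q)) = cJ (circ s q)"
    unfolding df_linear e1[symmetric] e2[symmetric] by (simp add: cJ_circ[OF s] algebra_simps)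
  then show ?thesis by blast
qed

lemma unit_tangent_perp_E1:
  assumes q: "q \<in> U" and v: "v = df f q u" "v \<bullet> v = 1" "v \<bullet> E1 q = 0"
  shows "v = E2 q \<or> v = - E2 q"
proof -
  obtain c where "tangent_frame f U q c (perp f q (E1 q)) (E1 q) (E2 q)" using frame[OF q] by blast
  then interpret tangent_frame f U q c "perp f q (E1 q)" "E1 q" "E2 q" .
  define t where "t = v \<bullet> E2 q"
  have vt: "v = t *\<^sub>R E2 q" using df_expand[of u] v by (simp add: t_def)
  then have "t * t = 1" using v(2) E_inner(2)[OF q] by simp
  then have "t = 1 \<or> t = - 1" by (simp add: square_eq_1_iff)
  with vt show ?thesis by auto
qed

end

section \<open>Matching charts with the torus\<close>

text \<open>The vector \<open>E1\<close> is a function of the position alone, and in a common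
  tangent plane the unit vector orthogonal to it is unique up to sign.\<close>

lemma E2_chart_change:
  assumes f: "sphere_chart f U" and g: "sphere_chart g V"
    and p: "p \<in> U" "p' \<in> V" and eq: "f p = g p'" and tan: "\<And>u. \<exists>w. df f p u = df g p' w"
  shows "sphere_chart.E2 f p = sphere_chart.E2 g p' \<or> sphere_chart.E2 f p = - sphere_chart.E2 g p'"
proof -
  interpret f: sphere_chart f U by (rule f)
  interpret g: sphere_chart g V by (rule g)
  obtain w where w: "f.E2 p = df g p' w" using tan unfolding f.E2_def by blast
  have "f.E1 p = g.E1 p'" by (simp add: f.E1_def g.E1_def eq)
  then show ?thesis
    using g.unit_tangent_perp_E1[OF p(2) w] f.E_inner[OF p(1)] by simp
qed

text \<open>For a unitary pair \<open>a\<close>, \<open>b\<close>, the equations say that one of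
  \<open>circ 1\<close>, \<open>circ (- 1)\<close> lies in the complex line of \<open>a\<close> and
  the other in that of \<open>b\<close>. Quantifying over \<open>s\<close> forgets which is which,
  since reversing \<open>E2\<close> exchanges them.\<close>

definition aligned :: "complex \<times> complex \<Rightarrow> complex \<times> complex \<Rightarrow> param \<Rightarrow> real \<times> real \<Rightarrow> bool" where
  "aligned a b f p \<longleftrightarrow> (\<exists>s. s * s = 1 \<and> herm (sphere_chart.circ f s p) b = 0
     \<and> herm (sphere_chart.circ f (- s) p) a = 0)"

lemma aligned_chart_change:
  assumes f: "sphere_chart f U" and g: "sphere_chart g V"
    and p: "p \<in> U" "p' \<in> V" and eq: "f p = g p'" and tan: "\<And>u. \<exists>w. df f p u = df g p' w"
    and al: "aligned a b f p"
  shows "aligned a b g p'"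
proof -
  interpret f: sphere_chart f U by (rule f)
  interpret g: sphere_chart g V by (rule g)
  obtain s where s: "s * s = 1" "herm (f.circ s p) b = 0" "herm (f.circ (- s) p) a = 0"
    using al unfolding aligned_def by blast
  from E2_chart_change[OF f g p eq tan] show ?thesis
  proof
    assume "f.E2 p = g.E2 p'"
    then have "f.circ t p = g.circ t p'" for t by (simp add: f.circ_def g.circ_def eq)
    with s show ?thesis unfolding aligned_def by metis
  next
    assume "f.E2 p = - g.E2 p'"
    then have "f.circ t p = g.circ (- t) p'" for t by (simp add: f.circ_def g.circ_def eq cJ_minus)
    with s have "(- s) * (- s) = 1" "herm (g.circ (- s) p') b = 0" "herm (g.circ (- (- s)) p') a = 0"
      by simp_all
    then show ?thesis unfolding aligned_def by blast
  qed
qed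

text \<open>Alignment is the vanishing of moduli that \<open>herm_circ_const\<close> shows to be
  constant, so the same \<open>s\<close> works at both points.\<close>

lemma aligned_on_convex:
  assumes f: "sphere_chart f U" and S: "convex S" "open S" "S \<subseteq> U" and pq: "p \<in> S" "q \<in> S"
    and al: "aligned a b f p"
  shows "aligned a b f q"
proof -
  interpret f: sphere_chart f U by (rule f)
  obtain s where s: "s * s = 1" "herm (f.circ s p) b = 0" "herm (f.circ (- s) p) a = 0"
    using al unfolding aligned_def by blast
  have "cmod (herm (f.circ s q) b) = 0" "cmod (herm (f.circ (- s) q) a) = 0"
    using f.herm_circ_const[OF S _ pq, of s b] f.herm_circ_const[OF S _ pq, of "- s" a] s by simp_all
  then show ?thesis using s(1) unfolding aligned_def by auto
qed

section \<open>Unitary coordinates and openness in the torus\<close>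

lemma hermitian_parseval:
  assumes "norm a = 1" "norm b = 1" "herm a b = 0"
  shows "(cmod (herm z a))\<^sup>2 + (cmod (herm z b))\<^sup>2 = (norm z)\<^sup>2"
proof -
  have ab: "a \<bullet> b = 0" "a \<bullet> cJ b = 0" using assms(3) by (simp_all add: herm_inner complex_eq_iff)
  have "z \<bullet> z = z \<bullet> ((z \<bullet> a) *\<^sub>R a + (z \<bullet> b) *\<^sub>R b + (z \<bullet> cJ a) *\<^sub>R cJ a + (z \<bullet> cJ b) *\<^sub>R cJ b)"
    using lagrangian_frame_expand[OF assms(1,2) ab, of z] by simp
  then have "z \<bullet> z = (z \<bullet> a)\<^sup>2 + (z \<bullet> cJ a)\<^sup>2 + ((z \<bullet> b)\<^sup>2 + (z \<bullet> cJ b)\<^sup>2)"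
    by (simp add: inner_add_right power2_eq_square)
  then show ?thesis
    by (simp add: herm_inner cmod_power2 power2_norm_eq_inner)
qed

lemma unitary_isometry:
  assumes "norm a = 1" "norm b = 1" "herm a b = 0"
  shows "dist (herm u a, herm u b) (herm v a, herm v b) = dist u v"
  using hermitian_parseval[OF assms, of "u - v"] by (simp add: dist_norm norm_Pair flip: herm_diff)

lemma connected_clifford_torus: "connected clifford_torus"
proof -
  have "clifford_torus = sphere 0 1 \<times> sphere 0 1" by (auto simp: clifford_torus_def)
  moreover have "connected (sphere (0::complex) 1)" by (intro connected_sphere) simp
  ultimately show ?thesis using connected_Times by metis
qed

text \<open>In the coordinates \<open>herm z a\<close>, \<open>herm z b\<close>, one of the two
  circle vectors supplies each component of \<open>x\<close>. The tangent vectors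
  \<open>J (circ s)\<close> and \<open>J (circ (- s))\<close> rotate one factor while fixing the
  other.\<close>

lemma aligned_components:
  assumes f: "sphere_chart f U" and p: "p \<in> U" and al: "aligned a b f p"
    and ab: "norm a = 1" "norm b = 1" "herm a b = 0"
  shows "cmod (herm (f p) a) = 1" "cmod (herm (f p) b) = 1"
    and "\<exists>u. herm (df f p u) a = \<i> * herm (f p) a \<and> herm (df f p u) b = 0"
    and "\<exists>u. herm (df f p u) a = 0 \<and> herm (df f p u) b = \<i> * herm (f p) b"
proof -
  interpret f: sphere_chart f U by (rule f)
  obtain s where s: "s * s = 1" "herm (f.circ s p) b = 0" "herm (f.circ (- s) p) a = 0"
    using al unfolding aligned_def by blast
  have s': "- s * - s = 1" using s(1) by simp
  have "s = 1 \<or> s = - 1" using s(1) by (simp add: square_eq_1_iff)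
  then have sum: "f p = f.circ s p + f.circ (- s) p"
    using f.circ_sum[of p] by (auto simp: add.commute)
  have fa: "herm (f p) a = herm (f.circ s p) a" and fb: "herm (f p) b = herm (f.circ (- s) p) b"
    using s by (simp_all add: sum herm_add)
  have "(cmod (herm (f p) a))\<^sup>2 = 1" "(cmod (herm (f p) b))\<^sup>2 = 1"
    using hermitian_parseval[OF ab, of "f.circ s p"] hermitian_parseval[OF ab, of "f.circ (- s) p"]
      f.norm_circ[OF p s(1)] f.norm_circ[OF p s'] s by (simp_all add: fa fb)
  then show "cmod (herm (f p) a) = 1" "cmod (herm (f p) b) = 1"
    by (simp_all add: power2_eq_1_iff norm_ge_zero) (smt (verit) norm_ge_zero)+
  obtain u v where "df f p u = cJ (f.circ s p)" "df f p v = cJ (f.circ (- s) p)"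
    using f.cJ_circ_tangent[OF p s(1)] f.cJ_circ_tangent[OF p s'] by blast
  then show "\<exists>u. herm (df f p u) a = \<i> * herm (f p) a \<and> herm (df f p u) b = 0"
    "\<exists>u. herm (df f p u) a = 0 \<and> herm (df f p u) b = \<i> * herm (f p) b"
    using s by (metis fa fb herm_cJ mult_zero_right)+
qed

text \<open>Scaling the two factors of the torus by \<open>exp \<alpha>\<close> and \<open>exp \<beta>\<close> turns the chart into a map between
  spaces of the same dimension with surjective derivative, so its image is a neighbourhood.\<close>

lemma chart_image_open_in_torus:
  assumes f: "sphere_chart f U" and al: "\<And>q. q \<in> U \<Longrightarrow> aligned a b f q"
    and ab: "norm a = 1" "norm b = 1" "herm a b = 0"
  shows "openin (top_of_set clifford_torus) ((\<lambda>q. (herm (f q) a, herm (f q) b)) ` U)"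
proof -
  interpret f: sphere_chart f U by (rule f)
  note comp = aligned_components[OF f _ al ab]
  let ?z = "\<lambda>q. (herm (f q) a, herm (f q) b)"
  let ?\<Psi> = "\<lambda>y :: (real \<times> real) \<times> (real \<times> real).
    (exp (fst (snd y)) *\<^sub>R herm (f (fst y)) a, exp (snd (snd y)) *\<^sub>R herm (f (fst y)) b)"
  have cz: "continuous_on U (\<lambda>q. herm (f q) c)" for c
    by (rule bounded_linear.continuous_on[OF bounded_linear_herm f.continuous_f])
  have c\<Psi>: "continuous_on (U \<times> UNIV) ?\<Psi>"
    by (intro continuous_intros continuous_on_compose2[OF cz]) auto
  have int: "?\<Psi> (p, 0) \<in> interior (?\<Psi> ` (U \<times> UNIV))" if p: "p \<in> U" for p
  proof -
    obtain u where u: "herm (df f p u) a = \<i> * herm (f p) a" "herm (df f p u) b = 0"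
      using comp(3)[OF p p] by blast
    obtain v where v: "herm (df f p v) a = 0" "herm (df f p v) b = \<i> * herm (f p) b"
      using comp(4)[OF p p] by blast
    let ?D = "\<lambda>h :: (real \<times> real) \<times> (real \<times> real).
       (herm (df f p (fst h)) a + fst (snd h) *\<^sub>R herm (f p) a,
        herm (df f p (fst h)) b + snd (snd h) *\<^sub>R herm (f p) b)"
    have hf: "((\<lambda>y. herm (f (fst y)) c) has_derivative (\<lambda>h. herm (df f p (fst h)) c)) (at (p, 0::real \<times> real))" for c
    proof -
      have "((\<lambda>y. f (fst y)) has_derivative (\<lambda>h. df f p (fst h))) (at (p, 0::real \<times> real))"
        by (rule has_derivative_compose[OF bounded_linear_imp_has_derivative[OF bounded_linear_fst]])
           (simp add: f.has_derivative_f[OF p])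
      then show ?thesis by (rule bounded_linear.has_derivative[OF bounded_linear_herm])
    qed
    have e: "((\<lambda>y :: (real \<times> real) \<times> (real \<times> real). exp (fst (snd y))) has_derivative (\<lambda>h. fst (snd h))) (at (p, 0))"
      "((\<lambda>y :: (real \<times> real) \<times> (real \<times> real). exp (snd (snd y))) has_derivative (\<lambda>h. snd (snd h))) (at (p, 0))"
      by (auto intro!: derivative_eq_intros)
    have D: "(?\<Psi> has_derivative ?D) (at (p, 0))"
      by (rule has_derivative_eq_rhs[OF has_derivative_Pair[OF has_derivative_scaleR[OF e(1) hf] has_derivative_scaleR[OF e(2) hf]]])
         (simp add: fun_eq_iff)
    \<comment> \<open>A right inverse of \<open>?D\<close>: each component is resolved along its
      unit value \<open>c\<close> and along \<open>i c\<close>. The part along \<open>c\<close> is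
      produced by the scaling parameter, the part along \<open>i c\<close> by the tangent vectors
      \<open>u\<close> and \<open>v\<close>.\<close>
    let ?g = "\<lambda>w :: complex \<times> complex. (Im (fst w * cnj (herm (f p) a)) *\<^sub>R u + Im (snd w * cnj (herm (f p) b)) *\<^sub>R v,
        (Re (fst w * cnj (herm (f p) a)), Re (snd w * cnj (herm (f p) b))))"
    have g: "bounded_linear ?g"
      by (intro bounded_linear_Pair bounded_linear_add bounded_linear_compose[OF bounded_linear_scaleR_left]
          bounded_linear_compose[OF bounded_linear_Im] bounded_linear_compose[OF bounded_linear_Re]
          bounded_linear_compose[OF bounded_linear_mult_left] bounded_linear_fst bounded_linear_snd)
    have one: "herm (f p) a * cnj (herm (f p) a) = 1" "herm (f p) b * cnj (herm (f p) b) = 1"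
      using comp(1,2)[OF p p] by (simp_all add: complex_norm_square[symmetric])
    have polar: "Im (w * cnj c) *\<^sub>R (\<i> * c) + Re (w * cnj c) *\<^sub>R c = w" if "c * cnj c = 1" for w c :: complex
    proof -
      have "Im (w * cnj c) *\<^sub>R (\<i> * c) + Re (w * cnj c) *\<^sub>R c
        = (of_real (Re (w * cnj c)) + \<i> * of_real (Im (w * cnj c))) * c"
        by (simp add: scaleR_conv_of_real algebra_simps)
      also have "\<dots> = w * cnj c * c" by (simp only: complex_eq[symmetric])
      also have "\<dots> = w * (c * cnj c)" by (simp only: mult_ac)
      finally show ?thesis using that by simp
    qed
    have "?D \<circ> ?g = id"
      using polar[OF one(1)] polar[OF one(2)]
      by (simp add: fun_eq_iff df_linear herm_add herm_scale u v prod_eq_iff)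
    from sussmann_open_mapping[OF _ c\<Psi> _ D g this, of "U \<times> UNIV"] p f.open_U show ?thesis
      by (simp add: open_Times interior_open)
  qed
  show ?thesis
  proof (subst openin_subopen, rule ballI)
    fix y assume y: "y \<in> ?z ` U"
    obtain p where p: "p \<in> U" "y = ?z p" using y by blast
    let ?T = "interior (?\<Psi> ` (U \<times> UNIV))"
    have "y \<in> clifford_torus" using comp(1,2)[OF p(1) p(1)] by (simp add: p(2) clifford_torus_def)
    moreover have "y \<in> ?T" using int[OF p(1)] by (simp add: p(2))
    moreover have "clifford_torus \<inter> ?T \<subseteq> ?z ` U"
    proof
      fix w assume w: "w \<in> clifford_torus \<inter> ?T"
      then have "w \<in> ?\<Psi> ` (U \<times> UNIV)" using interior_subset by blast
      then obtain y where y: "y \<in> U \<times> UNIV" "w = ?\<Psi> y" by blast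
      define q \<alpha> \<beta> where "q = fst y" and "\<alpha> = fst (snd y)" and "\<beta> = snd (snd y)"
      have q: "q \<in> U" "w = (exp \<alpha> *\<^sub>R herm (f q) a, exp \<beta> *\<^sub>R herm (f q) b)"
        using y by (auto simp: q_def \<alpha>_def \<beta>_def)
      \<comment> \<open>Both \<open>w\<close> and the unscaled point have components of modulus 1,
        so scaling adds no point of the torus to the image of the chart.\<close>
      have "exp \<alpha> = 1" "exp \<beta> = 1"
        using w q(2) comp(1,2)[OF q(1) q(1)] by (simp_all add: clifford_torus_def)
      then have "w = ?z q" by (simp add: q(2))
      with q(1) show "w \<in> ?z ` U" by blast
    qed
    ultimately show "\<exists>T. openin (top_of_set clifford_torus) T \<and> y \<in> T \<and> T \<subseteq> ?z ` U"
      using openin_open_Int[OF open_interior, of clifford_torus "?\<Psi> ` (U \<times> UNIV)"]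
      by (intro exI[of _ "clifford_torus \<inter> ?T"]) simp
  qed
qed

section \<open>Compact surfaces\<close>

locale compact_shrinker =
  fixes x :: "'m::t2_space \<Rightarrow> complex \<times> complex"
    and A :: "((real \<times> real) set \<times> (real \<times> real \<Rightarrow> 'm)) set"
  assumes comp: "compact (UNIV :: 'm set)"
    and conn: "connected (UNIV :: 'm set)"
    and atlas: "oriented_surface_atlas A"
    and smooth: "\<forall>(U,\<phi>)\<in>A. smooth_on U (x \<circ> \<phi>)"
    and imm: "\<forall>(U,\<phi>)\<in>A. \<forall>p\<in>U. immersion_at (x \<circ> \<phi>) p"
    and lag: "\<forall>(U,\<phi>)\<in>A. \<forall>p\<in>U. lagrangian_at (x \<circ> \<phi>) p"
    and shr: "\<forall>(U,\<phi>)\<in>A. \<forall>p\<in>U. self_shrinker_at (x \<circ> \<phi>) p"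
    and sq: "\<forall>(U,\<phi>)\<in>A. \<forall>p\<in>U. sqA (x \<circ> \<phi>) p \<le> 2"
begin

lemma chart_open: "(U, \<phi>) \<in> A \<Longrightarrow> open U"
  using atlas unfolding oriented_surface_atlas_def by blast

lemma chart_homeomorphism:
  assumes "(U, \<phi>) \<in> A"
  obtains \<psi> where "homeomorphism U (\<phi> ` U) \<phi> \<psi>" "open (\<phi> ` U)"
  using assms atlas unfolding oriented_surface_atlas_def by blast

lemma chart_cover: obtains U \<phi> p where "(U, \<phi>) \<in> A" "p \<in> U" "\<phi> p = m"
proof -
  have "m \<in> (\<Union>(U,\<phi>)\<in>A. \<phi> ` U)" using atlas unfolding oriented_surface_atlas_def by blast
  then show ?thesis using that by blast
qed

lemma transition_smooth:
  "(U, \<phi>) \<in> A \<Longrightarrow> (V, \<psi>) \<in> A \<Longrightarrow> smooth_on {p \<in> U. \<phi> p \<in> \<psi> ` V} (\<lambda>p. inv_into V \<psi> (\<phi> p))"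
  using atlas unfolding oriented_surface_atlas_def by blast

lemma chart_image_open:
  assumes "(U, \<phi>) \<in> A" "open W" "W \<subseteq> U"
  shows "open (\<phi> ` W)"
proof -
  obtain \<psi> where \<psi>: "homeomorphism U (\<phi> ` U) \<phi> \<psi>" "open (\<phi> ` U)"
    using chart_homeomorphism[OF assms(1)] by blast
  have "openin (top_of_set U) W" using assms(2,3) by (simp add: open_subset)
  then have "openin (top_of_set (\<phi> ` U)) (\<phi> ` W)"
    by (rule homeomorphism_imp_open_map[OF \<psi>(1)])
  then show ?thesis using \<psi>(2) openin_open_eq by blast
qed

lemma shrinker_chart: "(U, \<phi>) \<in> A \<Longrightarrow> shrinker_chart (x \<circ> \<phi>) U"
  using chart_open smooth imm lag shr by unfold_locales (auto simp: smooth_on_def)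

text \<open>Smoothness is given only for \<open>x\<close> in charts; continuity on the surface is
  recovered through the inverse charts, whose domains are open.\<close>

lemma continuous_x: "continuous_on UNIV x"
proof (rule continuous_at_imp_continuous_on, rule)
  fix m
  obtain U \<phi> p where c: "(U, \<phi>) \<in> A" "p \<in> U" "\<phi> p = m" by (rule chart_cover)
  interpret shrinker_chart "x \<circ> \<phi>" U by (rule shrinker_chart[OF c(1)])
  obtain \<psi> where \<psi>: "homeomorphism U (\<phi> ` U) \<phi> \<psi>" "open (\<phi> ` U)"
    using chart_homeomorphism[OF c(1)] by blast
  have \<psi>': "continuous_on (\<phi> ` U) \<psi>" "\<psi> ` (\<phi> ` U) = U" "\<And>m. m \<in> \<phi> ` U \<Longrightarrow> \<phi> (\<psi> m) = m"
    using \<psi>(1) by (auto simp: homeomorphism_def)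
  have "continuous_on (\<phi> ` U) ((x \<circ> \<phi>) \<circ> \<psi>)"
    by (rule continuous_on_compose[OF \<psi>'(1)]) (simp only: \<psi>'(2) continuous_f)
  then have "continuous_on (\<phi> ` U) x"
    by (rule continuous_on_eq) (simp add: \<psi>'(3))
  then show "isCont x m" using \<psi>(2) c by (auto simp: continuous_on_eq_continuous_at)
qed

lemma connected_cases:
  assumes "\<And>m. m \<in> S \<Longrightarrow> \<exists>T. open T \<and> m \<in> T \<and> T \<subseteq> S"
    and "\<And>m. m \<notin> S \<Longrightarrow> \<exists>T. open T \<and> m \<in> T \<and> T \<subseteq> - S" and "(m0::'m) \<in> S"
  shows "m \<in> S"
proof -
  have "open S" "open (- S)" using assms(1,2) by (subst open_subopen; force)+
  then have "S = UNIV" using conn assms(3) by (auto simp: connected_clopen closed_def)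
  then show ?thesis by simp
qed

lemma norm_max: "\<exists>m. x m \<bullet> x m = 2 \<and> (\<forall>m'. x m' \<bullet> x m' \<le> 2)"
proof -
  have "continuous_on UNIV (\<lambda>m. x m \<bullet> x m)" by (intro continuous_intros continuous_x)
  then obtain m0 where m0: "\<And>m. x m \<bullet> x m \<le> x m0 \<bullet> x m0"
    using continuous_attains_sup[OF comp, of "\<lambda>m. x m \<bullet> x m"] by auto
  obtain U \<phi> p where c: "(U, \<phi>) \<in> A" "p \<in> U" "\<phi> p = m0" by (rule chart_cover)
  interpret shrinker_chart "x \<circ> \<phi>" U by (rule shrinker_chart[OF c(1)])
  obtain r where r: "r > 0" "ball p r \<subseteq> U" using open_U c(2) openE by blast
  have "x m0 \<bullet> x m0 = 2"
    using norm_at_max[OF c(2) _ r] m0 sq c by auto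
  then show ?thesis using m0 by metis
qed

lemma norm_eq: "x m \<bullet> x m = 2"
proof -
  let ?S = "{m. x m \<bullet> x m = 2}"
  obtain m0 where m0: "x m0 \<bullet> x m0 = 2" and norm_le: "\<And>m. x m \<bullet> x m \<le> 2"
    using norm_max by blast
  have "m \<in> ?S"
  proof (rule connected_cases)
    show "m0 \<in> ?S" using m0 by simp
  next
    fix m assume m: "m \<in> ?S"
    obtain U \<phi> p where c: "(U, \<phi>) \<in> A" "p \<in> U" "\<phi> p = m" by (rule chart_cover)
    interpret shrinker_chart "x \<circ> \<phi>" U by (rule shrinker_chart[OF c(1)])
    obtain r where r: "r > 0" "ball p r \<subseteq> U" "\<And>q. q \<in> ball p r \<Longrightarrow> x (\<phi> q) \<bullet> x (\<phi> q) = 2"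
      using norm_max_spreads[of p] norm_le m c by auto
    have "open (\<phi> ` ball p r)" by (rule chart_image_open[OF c(1) _ r(2)]) simp
    moreover have "m \<in> \<phi> ` ball p r" using r(1) c(3) by auto
    moreover have "\<phi> ` ball p r \<subseteq> ?S" using r(3) by blast
    ultimately show "\<exists>T. open T \<and> m \<in> T \<and> T \<subseteq> ?S" by blast
  next
    fix m assume m: "m \<notin> ?S"
    have "open (- ?S)" 
      unfolding Compl_eq Collect_neg_eq[symmetric] mem_Collect_eq
      by (intro open_Collect_neq continuous_intros continuous_x)
    with m show "\<exists>T. open T \<and> m \<in> T \<and> T \<subseteq> - ?S" by blast
  qed
  then show ?thesis by simp
qed

lemma sphere_chart: "(U, \<phi>) \<in> A \<Longrightarrow> sphere_chart (x \<circ> \<phi>) U"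
  using shrinker_chart norm_eq by (intro sphere_chart.intro sphere_chart_axioms.intro) auto

text \<open>The chain rule for \<open>x o \<phi>\<close>, written near \<open>p\<close> as
  \<open>x o \<psi>\<close> after the transition map, puts each tangent vector of the first chart
  into the tangent plane of the second.\<close>

lemma tangent_chart_change:
  assumes U: "(U, \<phi>) \<in> A" and V: "(V, \<psi>) \<in> A" and p: "p \<in> U" "p' \<in> V" "\<phi> p = \<psi> p'"
  shows "\<exists>w. df (x \<circ> \<phi>) p u = df (x \<circ> \<psi>) p' w"
proof -
  interpret f: sphere_chart "x \<circ> \<phi>" U by (rule sphere_chart[OF U])
  interpret g: sphere_chart "x \<circ> \<psi>" V by (rule sphere_chart[OF V])
  let ?W = "{p \<in> U. \<phi> p \<in> \<psi> ` V}"
  let ?\<tau> = "\<lambda>p. inv_into V \<psi> (\<phi> p)"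
  obtain \<theta> where \<theta>: "homeomorphism U (\<phi> ` U) \<phi> \<theta>" using chart_homeomorphism[OF U] by blast
  obtain \<theta>' where \<theta>': "homeomorphism V (\<psi> ` V) \<psi> \<theta>'" "open (\<psi> ` V)" using chart_homeomorphism[OF V] by blast
  have "inj_on \<psi> V" using \<theta>'(1)
    by (intro inj_on_inverseI[of _ \<theta>']) (simp add: homeomorphism_def)
  then have \<tau>p: "?\<tau> p = p'" using p by simp
  have "continuous_on U \<phi>" using \<theta> by (simp add: homeomorphism_def)
  then have W: "open ?W"
    using continuous_open_preimage[OF _ f.open_U \<theta>'(2)] by (simp add: vimage_def Int_def)
  have pW: "p \<in> ?W" using p by simp
  have "Ck (Suc 0) ?W ?\<tau>" using transition_smooth[OF U V] by (simp only: smooth_on_def)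
  then have "?\<tau> differentiable (at p)" unfolding Ck.simps using pW by blast
  then obtain \<tau>' where \<tau>': "(?\<tau> has_derivative \<tau>') (at p)" unfolding differentiable_def by blast
  have "((x \<circ> \<psi>) has_derivative df (x \<circ> \<psi>) p') (at (?\<tau> p))"
    unfolding \<tau>p by (rule g.has_derivative_f[OF p(2)])
  from has_derivative_compose[OF \<tau>' this]
  have "((\<lambda>q. (x \<circ> \<psi>) (?\<tau> q)) has_derivative (\<lambda>h. df (x \<circ> \<psi>) p' (\<tau>' h))) (at p)" .
  then have "((x \<circ> \<phi>) has_derivative (\<lambda>h. df (x \<circ> \<psi>) p' (\<tau>' h))) (at p)"
    by (rule has_derivative_transform_within_open[OF _ W pW]) (simp add: f_inv_into_f)
  then have "df (x \<circ> \<phi>) p = (\<lambda>h. df (x \<circ> \<psi>) p' (\<tau>' h))"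
    using f.has_derivative_f[OF p(1)] has_derivative_unique by blast
  from fun_cong[OF this, of u] show ?thesis by blast
qed

lemma aligned_everywhere:
  assumes U0: "(U0, \<phi>0) \<in> A" "p0 \<in> U0" and al0: "aligned a b (x \<circ> \<phi>0) p0"
    and U: "(U, \<phi>) \<in> A" "p \<in> U"
  shows "aligned a b (x \<circ> \<phi>) p"
proof -
  \<comment> \<open>Membership asks for one suitable chart; invariance under chart change upgrades
    this to every chart at the point.\<close>
  define S where "S = {\<phi> p |U \<phi> p. (U, \<phi>) \<in> A \<and> p \<in> U \<and> aligned a b (x \<circ> \<phi>) p}"
  have S: "\<phi> p \<in> S \<longleftrightarrow> aligned a b (x \<circ> \<phi>) p" if c: "(U, \<phi>) \<in> A" "p \<in> U" for U \<phi> p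
  proof
    assume "\<phi> p \<in> S"
    then obtain V \<psi> q where V: "(V, \<psi>) \<in> A" "q \<in> V" "aligned a b (x \<circ> \<psi>) q" "\<phi> p = \<psi> q"
      unfolding S_def by blast
    show "aligned a b (x \<circ> \<phi>) p"
    proof (rule aligned_chart_change[OF sphere_chart[OF V(1)] sphere_chart[OF c(1)] V(2) c(2) _ _ V(3)])
      show "(x \<circ> \<psi>) q = (x \<circ> \<phi>) p" using V(4) by simp
      show "\<exists>w. df (x \<circ> \<psi>) q u = df (x \<circ> \<phi>) p w" for u
        by (rule tangent_chart_change[OF V(1) c(1) V(2) c(2) V(4)[symmetric]])
    qed
  qed (use c in \<open>unfold S_def, blast\<close>)
  \<comment> \<open>Alignment propagates both ways inside a coordinate ball, so membership in
    \<open>S\<close> is locally constant, which gives openness of \<open>S\<close> and of its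
    complement at once.\<close>
  have spread: "\<exists>T. open T \<and> m \<in> T \<and> (\<forall>m'\<in>T. m' \<in> S \<longleftrightarrow> m \<in> S)" for m
  proof -
    obtain U \<phi> p where c: "(U, \<phi>) \<in> A" "p \<in> U" "\<phi> p = m" by (rule chart_cover)
    obtain r where r: "r > 0" "ball p r \<subseteq> U" using chart_open[OF c(1)] c(2) openE by blast
    have "open (\<phi> ` ball p r)" by (rule chart_image_open[OF c(1) _ r(2)]) simp
    moreover have "m \<in> \<phi> ` ball p r" using r(1) c(3) by auto
    moreover have "\<phi> q \<in> S \<longleftrightarrow> m \<in> S" if q: "q \<in> ball p r" for q
    proof -
      have pb: "p \<in> ball p r" using r(1) by simp
      note sp = aligned_on_convex[OF sphere_chart[OF c(1)] convex_ball open_ball r(2)]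
      have "aligned a b (x \<circ> \<phi>) q \<longleftrightarrow> aligned a b (x \<circ> \<phi>) p"
        using sp[OF q pb] sp[OF pb q] by blast
      then show ?thesis using S[OF c(1)] c(2,3) q r(2) by (metis subsetD)
    qed
    ultimately show ?thesis by blast
  qed
  have "\<phi> p \<in> S"
  proof (rule connected_cases)
    show "\<phi>0 p0 \<in> S" using S[OF U0] al0 by simp
    show "\<exists>T. open T \<and> m \<in> T \<and> T \<subseteq> S" if "m \<in> S" for m using spread[of m] that by blast
    show "\<exists>T. open T \<and> m \<in> T \<and> T \<subseteq> - S" if "m \<notin> S" for m using spread[of m] that by blast
  qed
  then show ?thesis using S[OF U] by simp
qed

lemma isometric_to_clifford_torus:
  "\<exists>\<Phi> :: complex \<times> complex \<Rightarrow> complex \<times> complex.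
     (\<forall>u v. dist (\<Phi> u) (\<Phi> v) = dist u v) \<and> \<Phi> ` range x = clifford_torus"
proof -
  obtain U0 \<phi>0 p0 where c0: "(U0, \<phi>0) \<in> A" "p0 \<in> U0" using chart_cover by metis
  interpret f0: sphere_chart "x \<circ> \<phi>0" U0 by (rule sphere_chart[OF c0(1)])
  \<comment> \<open>The unitary basis consists of the two circle vectors at one base point, where
    alignment holds with \<open>s = 1\<close> by their Hermitian orthogonality.\<close>
  define a b where "a = f0.circ 1 p0" and "b = f0.circ (- 1) p0"
  have ab: "norm a = 1" "norm b = 1" "herm a b = 0"
    using f0.norm_circ[OF c0(2)] f0.herm_circ_circ[OF c0(2), of 1] by (simp_all add: a_def b_def)
  have ba: "herm b a = 0"
    using f0.herm_circ_circ[OF c0(2), of "- 1"] by (simp add: a_def b_def)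
  have "aligned a b (x \<circ> \<phi>0) p0"
    unfolding aligned_def by (rule exI[of _ 1]) (use ab ba in \<open>simp flip: a_def b_def\<close>)
  note al = aligned_everywhere[OF c0 this]
  define \<Phi> where "\<Phi> z = (herm z a, herm z b)" for z
  let ?T = "\<Phi> ` range x"
  have op: "openin (top_of_set clifford_torus) ?T"
  proof (subst openin_subopen, rule ballI)
    fix y assume "y \<in> ?T"
    then obtain m where m: "y = \<Phi> (x m)" by blast
    obtain U \<phi> p where c: "(U, \<phi>) \<in> A" "p \<in> U" "\<phi> p = m" by (rule chart_cover)
    let ?V = "(\<lambda>q. (herm ((x \<circ> \<phi>) q) a, herm ((x \<circ> \<phi>) q) b)) ` U"
    have "openin (top_of_set clifford_torus) ?V"
      by (rule chart_image_open_in_torus[OF sphere_chart[OF c(1)] al[OF c(1)] ab])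
    moreover have "y \<in> ?V" by (rule image_eqI[OF _ c(2)]) (simp add: m c(3) \<Phi>_def)
    moreover have "?V \<subseteq> ?T" by (rule image_subsetI) (simp add: \<Phi>_def)
    ultimately show "\<exists>V. openin (top_of_set clifford_torus) V \<and> y \<in> V \<and> V \<subseteq> ?T" by blast
  qed
  have "continuous_on UNIV \<Phi>"
    unfolding \<Phi>_def[abs_def]
    by (intro continuous_on_Pair linear_continuous_on bounded_linear_herm)
  then have "compact ?T"
    by (rule compact_continuous_image[OF continuous_on_subset[OF _ subset_UNIV]
          compact_continuous_image[OF continuous_x comp]])
  moreover have "?T \<subseteq> clifford_torus" using op by (rule openin_imp_subset)
  ultimately have "closedin (top_of_set clifford_torus) ?T"
    by (intro closed_subset compact_imp_closed)
  moreover have "?T \<noteq> {}" by simp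
  ultimately have "?T = clifford_torus"
    using connected_clifford_torus op unfolding connected_clopen by metis
  moreover have "dist (\<Phi> u) (\<Phi> v) = dist u v" for u v
    unfolding \<Phi>_def by (rule unitary_isometry[OF ab])
  ultimately show ?thesis by blast
qed

end

theorem theorem1p2:
  fixes x :: "'m::t2_space \<Rightarrow> complex \<times> complex"
    and A :: "((real \<times> real) set \<times> (real \<times> real \<Rightarrow> 'm)) set"
  assumes "compact (UNIV :: 'm set)"
    and "connected (UNIV :: 'm set)"
    and "oriented_surface_atlas A"
    and "\<forall>(U,\<phi>)\<in>A. smooth_on U (x \<circ> \<phi>)"
    and "\<forall>(U,\<phi>)\<in>A. \<forall>p\<in>U. immersion_at (x \<circ> \<phi>) p"
    and "\<forall>(U,\<phi>)\<in>A. \<forall>p\<in>U. lagrangian_at (x \<circ> \<phi>) p"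
    and "\<forall>(U,\<phi>)\<in>A. \<forall>p\<in>U. self_shrinker_at (x \<circ> \<phi>) p"
    and "\<forall>(U,\<phi>)\<in>A. \<forall>p\<in>U. sqA (x \<circ> \<phi>) p \<le> 2"
  shows "(\<forall>(U,\<phi>)\<in>A. \<forall>p\<in>U. sqA (x \<circ> \<phi>) p = 2) \<and>
         (\<exists>\<Phi> :: complex \<times> complex \<Rightarrow> complex \<times> complex.
             (\<forall>u v. dist (\<Phi> u) (\<Phi> v) = dist u v) \<and> \<Phi> ` range x = clifford_torus)"
proof -
  interpret compact_shrinker x A by (rule compact_shrinker.intro[OF assms])
  show ?thesis
    using sphere_chart.sqA_eq_2[OF sphere_chart] isometric_to_clifford_torus by blast
qed

end
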